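(* Let $q$ be a prime power and let $0<R\le 1$ be a rational number. Let $n,K,N\ge 1$ be sufficiently large integers with $K=RN$, and let $\varepsilon>0$. Let $C_{\rm out}$ be a random linear code over $\mathbb{F}_{q^n}$ generated by a uniformly random $K\times N$ matrix over $\mathbb{F}_{q^n}$. Let $C_{\rm in}^1,\dots,C_{\rm in}^N$ be random linear codes over $\mathbb{F}_q$, where $C_{\rm in}^i$ is generated by a uniformly random $n\times n$ matrix $G_i$ over $\mathbb{F}_q$, and the random choices of $C_{\rm out},G_1,\dots,G_N$ are all independent. Then, with probability at least $1-q^{-\Omega(nN)}$ over these choices, the concatenated code $C^*=C_{\rm out}\circ(C_{\rm in}^1,\dots,C_{\rm in}^N)$ is $\left(1-R-\varepsilon,q^{O(1/\varepsilon^2)}\right)_{led}$-list decodable. Further, with high probability $C^*$ has rate $R$.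
   Context: Code concatenation: for an outer code $C_{\rm out}$ over $\mathbb{F}_{q^n}$ of block length $N$ and inner linear codes $C_{\rm in}^i$ with generator matrices $G_i\in\mathbb{F}_q^{n\times n}$, the concatenated code consists of the words $(u_1G_1,\dots,u_NG_N)\in\mathbb{F}_q^{nN}$ for $(u_1,\dots,u_N)\in C_{\rm out}$, each $u_i\in\mathbb{F}_{q^n}$ viewed as a row vector in $\mathbb{F}_q^n$ via a fixed $\mathbb{F}_q$-linear identification. Erasure list decoding: for $c\in\Sigma^M$ and $y\in(\Sigma\cup\{?\})^M$ ($?$ denotes an erasure), write $c\simeq y$ if $c_i=y_i$ for every $i$ with $y_i\neq ?$; $\mathrm{wt}(y)$ is the number of erased positions of $y$. A code $C\subseteq\Sigma^M$ is $(\rho,L)_{led}$-list decodable if for every $y\in(\Sigma\cup\{?\})^M$ with $\mathrm{wt}(y)\le\rho M$, the number of $c\in C$ with $c\simeq y$ is at most $L$.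
   Formalization: The claim that C* has rate R with high probability is stated only for R < 1; for R = 1 it is false, since rate 1 would force all N random matrices G_i to be invertible, which has probability tending to 0. The list-decoding claim is stated for all 0 < R ≤ 1. *)

theory Defs
  imports Complex_Main "HOL-Algebra.Ring" "HOL-Algebra.Ring_Divisibility" "HOL-Library.FuncSet"
begin

definition vecs :: "nat \<Rightarrow> (nat \<Rightarrow> 'a::zero) set" where
  "vecs n = {v. \<forall>i\<ge>n. v i = 0}"

text \<open>F is (a copy of) F_{q^n}, whose elements are identified F_q-linearly with F_q^n:
  a field structure on F_q^n with coordinatewise addition, in which multiplication by the
  image c * 1_F of a scalar c of F_q is coordinatewise scalar multiplication.\<close>
definition ext_field_coords :: "nat \<Rightarrow> (nat \<Rightarrow> 'a::field) ring \<Rightarrow> bool" where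
  "ext_field_coords n F \<longleftrightarrow> field F \<and> carrier F = vecs n \<and>
     (\<forall>u\<in>vecs n. \<forall>v\<in>vecs n. u \<oplus>\<^bsub>F\<^esub> v = (\<lambda>i. u i + v i)) \<and>
     (\<forall>c. \<forall>v\<in>vecs n. (\<lambda>i. c * (\<one>\<^bsub>F\<^esub>) i) \<otimes>\<^bsub>F\<^esub> v = (\<lambda>i. c * v i))"

definition outer_mats :: "(nat \<Rightarrow> 'a) ring \<Rightarrow> nat \<Rightarrow> nat \<Rightarrow> (nat \<Rightarrow> nat \<Rightarrow> (nat \<Rightarrow> 'a)) set" where
  "outer_mats F K N = {..<K} \<rightarrow>\<^sub>E ({..<N} \<rightarrow>\<^sub>E carrier F)"

definition inner_mats :: "nat \<Rightarrow> nat \<Rightarrow> (nat \<Rightarrow> nat \<Rightarrow> nat \<Rightarrow> 'a) set" where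
  "inner_mats n N = {..<N} \<rightarrow>\<^sub>E ({..<n} \<rightarrow>\<^sub>E ({..<n} \<rightarrow>\<^sub>E UNIV))"

definition outer_code :: "(nat \<Rightarrow> 'a) ring \<Rightarrow> nat \<Rightarrow> nat \<Rightarrow> (nat \<Rightarrow> nat \<Rightarrow> (nat \<Rightarrow> 'a))
    \<Rightarrow> (nat \<Rightarrow> (nat \<Rightarrow> 'a)) set" where
  "outer_code F K N A =
     {(\<lambda>j. if j < N then finsum F (\<lambda>i. m i \<otimes>\<^bsub>F\<^esub> A i j) {..<K} else undefined)
       | m. m \<in> {..<K} \<rightarrow> carrier F}"

text \<open>Concatenated word (u_1 G_1, ..., u_N G_N) in F_q^{nN}; position t = j*n + k.\<close>
definition concat_word :: "nat \<Rightarrow> nat \<Rightarrow> (nat \<Rightarrow> nat \<Rightarrow> nat \<Rightarrow> 'a::field)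
    \<Rightarrow> (nat \<Rightarrow> (nat \<Rightarrow> 'a)) \<Rightarrow> 'a list" where
  "concat_word n N G u =
     map (\<lambda>t. \<Sum>l<n. u (t div n) l * G (t div n) l (t mod n)) [0..<n*N]"

definition concat_code :: "nat \<Rightarrow> nat \<Rightarrow> (nat \<Rightarrow> nat \<Rightarrow> nat \<Rightarrow> 'a::field)
    \<Rightarrow> (nat \<Rightarrow> (nat \<Rightarrow> 'a)) set \<Rightarrow> 'a list set" where
  "concat_code n N G Cout = concat_word n N G ` Cout"

text \<open>Erasure list decoding; None denotes the erasure symbol ?.\<close>
definition agrees :: "'a list \<Rightarrow> 'a option list \<Rightarrow> bool" where
  "agrees c y \<longleftrightarrow> length c = length y \<and> (\<forall>i<length y. y ! i \<noteq> None \<longrightarrow> y ! i = Some (c ! i))"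

definition erasure_wt :: "'a option list \<Rightarrow> nat" where
  "erasure_wt y = card {i. i < length y \<and> y ! i = None}"

definition led_list_decodable :: "real \<Rightarrow> real \<Rightarrow> nat \<Rightarrow> 'a list set \<Rightarrow> bool" where
  "led_list_decodable \<rho> L M C \<longleftrightarrow>
     (\<forall>y. length y = M \<longrightarrow> real (erasure_wt y) \<le> \<rho> * real M \<longrightarrow>
          real (card {c\<in>C. agrees c y}) \<le> L)"

definition code_rate :: "nat \<Rightarrow> nat \<Rightarrow> 'a list set \<Rightarrow> real" where
  "code_rate q M C = log (real q) (real (card C)) / real M"

definition unif_prob :: "'x set \<Rightarrow> ('x \<Rightarrow> bool) \<Rightarrow> real" where
  "unif_prob \<Omega> P = real (card {\<omega>\<in>\<Omega>. P \<omega>}) / real (card \<Omega>)"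

end

theory Submission
  imports Defs "HOL-Library.Function_Algebras" "HOL-Library.Cardinality"
begin

text \<open>
  All counting is done with cardinalities, without bases or dimensions. For an \<open>F\<^sub>q\<close>-subspace \<open>V\<close> of the message
  space \<open>F ^ K\<close> let \<open>p V\<close> be the probability that a random column is orthogonal to \<open>V\<close>, so that
  \<open>1 / p V\<close> is the size of the \<open>F\<close>-span of \<open>V\<close>. Within one block with column \<open>a\<close>, the
  probability that all messages of \<open>V\<close> are encoded to words vanishing on \<open>s\<close> given positions is
  \<open>(card W / card V) ^ s\<close> with \<open>W = V \<inter> a\<^sup>\<bottom>\<close>; summing over \<open>W\<close> gives at most
  \<open>2 ^ card V * p V powr (s / n)\<close>.

  If more than \<open>q powr (13 / \<epsilon>\<^sup>2)\<close> codewords agree with a received word, some \<open>V\<close> with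
  \<open>q ^ D\<close> elements, \<open>D \<approx> 12 / \<epsilon>\<^sup>2\<close>, is encoded to words vanishing on all unerased positions.
  If the \<open>F\<close>-span of \<open>V\<close> has dimension at least \<open>2 / \<epsilon>\<close>, the block bound beats the
  union bound over all erasure patterns. Otherwise \<open>V\<close> is large compared with its span, and a
  subspace maximising \<open>card W * p W powr (4 / (\<epsilon> n))\<close> is nonzero; for such a subspace, blocks
  with at least \<open>\<epsilon> n / 2\<close> unerased positions contribute a factor \<open>p W\<close> even after a union
  bound over the positions inside the block, so only the set of these blocks must be guessed.
\<close>

section \<open>Duality by double counting\<close>

text \<open>Subgroups are plain subsets of an additive type, here functions with pointwise
  operations. Containing \<open>0\<close> and being closed under subtraction is the one-condition
  subgroup test.\<close>

definition diff_closed :: "'b::ab_group_add set \<Rightarrow> bool" where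
  "diff_closed X \<longleftrightarrow> 0 \<in> X \<and> (\<forall>x\<in>X. \<forall>y\<in>X. x - y \<in> X)"

lemma diff_closed_add:
  assumes "diff_closed X" "x \<in> X" "y \<in> X"
  shows "x + y \<in> X"
proof -
  have "x - (0 - y) \<in> X" using assms unfolding diff_closed_def by blast
  then show ?thesis by simp
qed

text \<open>Translation by a preimage is a bijection between a nonempty fibre and the kernel, so all
  fibres over the image have the same size.\<close>

lemma card_fibres:
  fixes h :: "'b::ab_group_add \<Rightarrow> 'c::ab_group_add"
  assumes fin: "finite X" and X: "diff_closed X"
    and h: "\<And>x y. x \<in> X \<Longrightarrow> y \<in> X \<Longrightarrow> h (x - y) = h x - h y"
  shows "card X = card (h ` X) * card {x\<in>X. h x = 0}"
proof -
  have "card {x\<in>X. h x = y} = card {x\<in>X. h x = 0}" if "y \<in> h ` X" for y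
  proof -
    from that obtain x0 where x0: "x0 \<in> X" "h x0 = y" by blast
    have "bij_betw (\<lambda>x. x - x0) {x\<in>X. h x = y} {x\<in>X. h x = 0}"
    proof (rule bij_betw_byWitness[where f' = "\<lambda>x. x + x0"])
      show "(\<lambda>x. x - x0) ` {x \<in> X. h x = y} \<subseteq> {x \<in> X. h x = 0}"
        using X x0 h unfolding diff_closed_def by auto
      have "h (x + x0) = y" if "x \<in> X" "h x = 0" for x
        using h[OF diff_closed_add[OF X that(1) x0(1)] x0(1)] that x0 by simp
      then show "(\<lambda>x. x + x0) ` {x \<in> X. h x = 0} \<subseteq> {x \<in> X. h x = y}"
        using diff_closed_add[OF X _ x0(1)] by auto
    qed auto
    then show ?thesis by (rule bij_betw_same_card)
  qed
  then have "(\<Sum>y\<in>h ` X. \<Sum>x | x \<in> X \<and> h x = y. (1::nat)) = (\<Sum>y\<in>h ` X. card {x\<in>X. h x = 0})"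
    by (intro sum.cong) auto
  moreover have "card X = (\<Sum>y\<in>h ` X. \<Sum>x | x \<in> X \<and> h x = y. (1::nat))"
    using sum.image_gen[OF fin, of "\<lambda>_. 1::nat" h] by simp
  ultimately show ?thesis by simp
qed

text \<open>Counting the pairs with \<open>\<beta> x y = 0\<close> in both orders yields the duality formula
  without choosing bases.\<close>
lemma card_annihilator:
  fixes \<beta> :: "'b::ab_group_add \<Rightarrow> 'c::ab_group_add \<Rightarrow> 'd::ab_group_add"
  assumes fin: "finite X" "finite Y" and X: "diff_closed X" and Y: "diff_closed Y"
    and left: "\<And>x x' y. x \<in> X \<Longrightarrow> x' \<in> X \<Longrightarrow> y \<in> Y \<Longrightarrow> \<beta> (x - x') y = \<beta> x y - \<beta> x' y"
    and right: "\<And>x y y'. x \<in> X \<Longrightarrow> y \<in> Y \<Longrightarrow> y' \<in> Y \<Longrightarrow> \<beta> x (y - y') = \<beta> x y - \<beta> x y'"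
    and Z: "2 \<le> card Z"
    and nondeg: "\<And>x. x \<in> X \<Longrightarrow> x \<noteq> 0 \<Longrightarrow> \<beta> x ` Y = Z"
    and onto: "\<And>y. y \<in> Y \<Longrightarrow> (\<forall>x\<in>X. \<beta> x y = 0) \<or> (\<lambda>x. \<beta> x y) ` X = Z"
  shows "card X * card {y\<in>Y. \<forall>x\<in>X. \<beta> x y = 0} = card Y"
proof -
  define q where "q = card Z"
  define A where "A = {y\<in>Y. \<forall>x\<in>X. \<beta> x y = 0}"
  have A: "A \<subseteq> Y" "finite A" using fin by (auto simp: A_def)
  have 0: "0 \<in> X" using X by (simp add: diff_closed_def)
  have zero: "\<beta> 0 y = 0" if "y \<in> Y" for y using left[OF 0 0 that] by simp
  \<comment> \<open>For nonzero \<open>x\<close> the map \<open>\<beta> x\<close> has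
    \<open>q\<close> values, so its kernel is the fraction \<open>1 / q\<close> of \<open>Y\<close>;
    \<open>x = 0\<close> contributes all of \<open>Y\<close>.\<close>
  have "(\<Sum>x\<in>X. q * card {y\<in>Y. \<beta> x y = 0}) = (\<Sum>x\<in>X. if x = 0 then q * card Y else card Y)"
  proof (intro sum.cong refl)
    fix x assume x: "x \<in> X"
    show "q * card {y\<in>Y. \<beta> x y = 0} = (if x = 0 then q * card Y else card Y)"
    proof (cases "x = 0")
      case True
      have "{y\<in>Y. \<beta> x y = 0} = Y" using True zero by auto
      with True show ?thesis by simp
    next
      case False
      then show ?thesis using card_fibres[of Y "\<beta> x"] fin Y right x nondeg[OF x False]
        by (simp add: q_def)
    qed
  qed
  also have "\<dots> = q * card Y + (card X - 1) * card Y"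
    using 0 fin by (subst sum.remove[of _ 0]) (auto simp: card_Diff_singleton)
  finally have 1: "(\<Sum>x\<in>X. q * card {y\<in>Y. \<beta> x y = 0}) = q * card Y + (card X - 1) * card Y" .
  \<comment> \<open>Symmetrically, an element of \<open>A\<close> contributes all of
    \<open>X\<close> and any other \<open>y\<close> the fraction \<open>1 / q\<close> of it.\<close>
  have "(\<Sum>y\<in>Y. q * card {x\<in>X. \<beta> x y = 0}) = (\<Sum>y\<in>Y. if y \<in> A then q * card X else card X)"
  proof (intro sum.cong refl)
    fix y assume y: "y \<in> Y"
    show "q * card {x\<in>X. \<beta> x y = 0} = (if y \<in> A then q * card X else card X)"
    proof (cases "y \<in> A")
      case True
      have "{x\<in>X. \<beta> x y = 0} = X" using True by (auto simp: A_def)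
      with True show ?thesis by simp
    next
      case False
      then have "(\<lambda>x. \<beta> x y) ` X = Z" using onto[OF y] y by (auto simp: A_def)
      then show ?thesis using False card_fibres[of X "\<lambda>x. \<beta> x y"] fin X left y
        by (simp add: q_def)
    qed
  qed
  also have "\<dots> = card A * (q * card X) + (card Y - card A) * card X"
    using fin A by (subst sum.If_cases) (auto simp: Int_absorb1 card_Diff_subset Diff_eq[symmetric])
  finally have 2: "(\<Sum>y\<in>Y. q * card {x\<in>X. \<beta> x y = 0}) =
      card A * (q * card X) + (card Y - card A) * card X" .
  have "(\<Sum>x\<in>X. card {y\<in>Y. \<beta> x y = 0}) = (\<Sum>y\<in>Y. card {x\<in>X. \<beta> x y = 0})"
    using fin by (intro sum_multicount_gen) auto
  then have eq: "q * card Y + (card X - 1) * card Y = card A * (q * card X) + (card Y - card A) * card X"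
    using 1 2 by (simp add: sum_distrib_left[symmetric])
  \<comment> \<open>These bounds turn the truncated subtractions into real ones. Then
    \<open>card X * card Y\<close> cancels and both sides keep the nonzero factor
    \<open>q - 1\<close>.\<close>
  have "card X \<ge> 1" using 0 fin by (simp add: Suc_le_eq card_gt_0_iff) blast
  moreover have "card A \<le> card Y" using A fin by (simp add: card_mono)
  ultimately have "real q * card Y + (real (card X) - 1) * card Y
      = card A * (real q * card X) + (real (card Y) - card A) * card X"
    using arg_cong[OF eq, of real] by (simp only: of_nat_mult of_nat_add of_nat_diff of_nat_1)
  then have "(real q - 1) * (real (card X) * card A) = (real q - 1) * card Y"
    by (simp add: algebra_simps)
  moreover have "real q - 1 \<noteq> 0" using Z by (simp add: q_def)
  ultimately have "real (card X) * card A = card Y" by simp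
  then show ?thesis by (simp add: A_def flip: of_nat_mult)
qed

section \<open>Message space over the extension field\<close>

text \<open>Restriction and extension by zero match these functions with the extensional ones. Zero
  is the default value because it is compatible with pointwise arithmetic; the count serves for
  F_q^n and for \<open>F ^ K\<close>.\<close>

lemma card_zero_extended:
  fixes B :: "'b::zero set"
  shows "card {f. (\<forall>i\<in>{..<k}. f i \<in> B) \<and> (\<forall>i\<ge>k. f i = 0)} = card B ^ k"
    and "finite B \<Longrightarrow> finite {f :: nat \<Rightarrow> 'b. (\<forall>i\<in>{..<k}. f i \<in> B) \<and> (\<forall>i\<ge>k. f i = 0)}"
proof -
  let ?X = "{f. (\<forall>i\<in>{..<k}. f i \<in> B) \<and> (\<forall>i\<ge>k. f i = 0)}"
  have bij: "bij_betw (\<lambda>f. \<lambda>i. if i < k then f i else 0) ({..<k} \<rightarrow>\<^sub>E B) ?X"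
    by (rule bij_betw_byWitness[where f' = "\<lambda>f. restrict f {..<k}"])
       (auto simp: fun_eq_iff PiE_def extensional_def)
  show "card ?X = card B ^ k"
    using bij_betw_same_card[OF bij] by (simp add: card_funcsetE)
  show "finite ?X" if "finite B"
    using bij_betw_finite[OF bij] that by (simp add: finite_PiE)
qed

section \<open>Coordinate vectors over F_q\<close>

lemma card_vecs: "card (vecs n :: (nat \<Rightarrow> 'a::{finite,zero}) set) = CARD('a) ^ n"
  and finite_vecs: "finite (vecs n :: (nat \<Rightarrow> 'a::{finite,zero}) set)"
  using card_zero_extended[where B = "UNIV :: 'a set" and k = n] by (simp_all add: vecs_def)

lemma two_le_card_field: "2 \<le> CARD('a::{finite,field})"
proof -
  have "card {0, 1 :: 'a} \<le> CARD('a)" by (rule card_mono) auto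
  then show ?thesis by simp
qed

lemma vecs_closed:
  fixes u v :: "nat \<Rightarrow> 'a::ring"
  shows "0 \<in> vecs n" "u \<in> vecs n \<Longrightarrow> v \<in> vecs n \<Longrightarrow> u + v \<in> vecs n"
    "u \<in> vecs n \<Longrightarrow> v \<in> vecs n \<Longrightarrow> u - v \<in> vecs n" "u \<in> vecs n \<Longrightarrow> (\<lambda>i. c * u i) \<in> vecs n"
  by (auto simp: vecs_def)

lemma sum_vecs:
  fixes f :: "'b \<Rightarrow> nat \<Rightarrow> 'a::ring"
  shows "(\<And>i. i \<in> A \<Longrightarrow> f i \<in> vecs n) \<Longrightarrow> sum f A \<in> vecs n"
  by (induction A rule: infinite_finite_induct) (auto simp: vecs_closed)

lemma sum_fun_apply: "sum f A x = (\<Sum>i\<in>A. f i x)"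
  by (induction A rule: infinite_finite_induct) auto

section \<open>The standard bilinear form over F_q\<close>

definition dot :: "nat \<Rightarrow> (nat \<Rightarrow> 'a::field) \<Rightarrow> (nat \<Rightarrow> 'a) \<Rightarrow> 'a" where
  "dot n u g = (\<Sum>l<n. u l * g l)"

lemma dot_diff: "dot n (u - v) g = dot n u g - dot n v g" "dot n u (g - h) = dot n u g - dot n u h"
  by (auto simp: dot_def algebra_simps sum_subtractf)

lemma dot_scale: "dot n (\<lambda>l. c * u l) g = c * dot n u g" "dot n u (\<lambda>l. c * g l) = c * dot n u g"
  by (auto simp: dot_def algebra_simps sum_distrib_left)

text \<open>The duality formula with all of F_q as set of values: unit vectors show nondegeneracy,
  and scaling gives surjectivity.\<close>

lemma card_dot_annihilator:
  fixes U :: "(nat \<Rightarrow> 'a::{finite,field}) set"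
  assumes U: "U \<subseteq> vecs n" "diff_closed U" and scale: "\<And>c u. u \<in> U \<Longrightarrow> (\<lambda>l. c * u l) \<in> U"
  shows "card U * card {g\<in>vecs n. \<forall>u\<in>U. dot n u g = 0} = CARD('a) ^ n"
proof -
  \<comment> \<open>A homogeneous map with one nonzero value on a set closed under scalars takes
    every value there.\<close>
  have onto: "f ` X = UNIV" if "x \<in> X" "f x \<noteq> 0" "\<And>c x. x \<in> X \<Longrightarrow> (\<lambda>l. c * x l) \<in> X"
    "\<And>c x. f (\<lambda>l. c * x l) = c * f x" for X x and f :: "(nat \<Rightarrow> 'a) \<Rightarrow> 'a"
  proof -
    have "y = f (\<lambda>l. (y / f x) * x l)" for y by (simp only: that(4)) (use that(2) in simp)
    then show ?thesis using that(1,3) by blast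
  qed
  have "card U * card {g\<in>vecs n. \<forall>u\<in>U. dot n u g = 0} = card (vecs n :: (nat \<Rightarrow> 'a) set)"
  proof (rule card_annihilator[where Z = UNIV])
    show "finite U" using U finite_vecs finite_subset by blast
    show "2 \<le> CARD('a)" by (rule two_le_card_field)
    show "dot n u ` vecs n = UNIV" if "u \<in> U" "u \<noteq> 0" for u
    proof -
      obtain i where i: "u i \<noteq> 0" using \<open>u \<noteq> 0\<close> by (auto simp: fun_eq_iff)
      then have "i < n" using U \<open>u \<in> U\<close> by (auto simp: vecs_def not_less[symmetric])
      let ?e = "\<lambda>l. if l = i then 1 else 0 :: 'a"
      have "dot n u ?e = u i" using \<open>i < n\<close> by (simp add: dot_def if_distrib sum.delta cong: if_cong)
      moreover have "?e \<in> vecs n" using \<open>i < n\<close> by (simp add: vecs_def)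
      ultimately show ?thesis using i vecs_closed(4) by (intro onto[of ?e]) (auto simp: dot_scale)
    qed
    show "(\<forall>x\<in>U. dot n x y = 0) \<or> (\<lambda>x. dot n x y) ` U = UNIV" for y
      using onto[of _ U "\<lambda>x. dot n x y"] scale by (auto simp: dot_scale)
  qed (use U in \<open>auto simp: dot_diff finite_vecs diff_closed_def vecs_closed\<close>)
  then show ?thesis by (simp add: card_vecs)
qed

text \<open>The facts about multiplication in the extension field on which the counting rests.
  Addition is pointwise addition of coordinate vectors, and division enters only through
  \<open>mul_onto\<close>.\<close>

locale coord_field =
  fixes n K q :: nat and mul :: "(nat \<Rightarrow> 'a::{finite,field}) \<Rightarrow> (nat \<Rightarrow> 'a) \<Rightarrow> (nat \<Rightarrow> 'a)"
  assumes n_pos: "0 < n"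
    and card_UNIV_eq [simp]: "CARD('a) = q"
    and mul_closed: "u \<in> vecs n \<Longrightarrow> v \<in> vecs n \<Longrightarrow> mul u v \<in> vecs n"
    and mul_comm: "u \<in> vecs n \<Longrightarrow> v \<in> vecs n \<Longrightarrow> mul u v = mul v u"
    and mul_assoc: "u \<in> vecs n \<Longrightarrow> v \<in> vecs n \<Longrightarrow> w \<in> vecs n \<Longrightarrow> mul (mul u v) w = mul u (mul v w)"
    and mul_add_left: "u \<in> vecs n \<Longrightarrow> v \<in> vecs n \<Longrightarrow> w \<in> vecs n \<Longrightarrow> mul (u + v) w = mul u w + mul v w"
    and mul_scale_left: "u \<in> vecs n \<Longrightarrow> v \<in> vecs n \<Longrightarrow> mul (\<lambda>l. c * u l) v = (\<lambda>l. c * mul u v l)"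
    and mul_onto: "u \<in> vecs n \<Longrightarrow> u \<noteq> 0 \<Longrightarrow> w \<in> vecs n \<Longrightarrow> \<exists>v\<in>vecs n. mul v u = w"
begin

text \<open>The space \<open>F ^ K\<close>, used both for messages and for the columns of the outer
  generator matrix.\<close>

definition msgs :: "(nat \<Rightarrow> nat \<Rightarrow> 'a) set" where
  "msgs = {m. (\<forall>i\<in>{..<K}. m i \<in> vecs n) \<and> (\<forall>i\<ge>K. m i = 0)}"

definition ip :: "(nat \<Rightarrow> nat \<Rightarrow> 'a) \<Rightarrow> (nat \<Rightarrow> nat \<Rightarrow> 'a) \<Rightarrow> nat \<Rightarrow> 'a" where
  "ip m a = (\<Sum>i<K. mul (m i) (a i))"

text \<open>Two kinds of scalars occur: F_q acts by \<open>sc\<close>, the extension field by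
  \<open>fsc\<close>, with subspaces \<open>subsp\<close> and \<open>fsubsp\<close>. Encoding is
  only F_q-linear, so the message sets to be excluded are only \<open>subsp\<close>.\<close>

definition sc :: "'a \<Rightarrow> (nat \<Rightarrow> nat \<Rightarrow> 'a) \<Rightarrow> nat \<Rightarrow> nat \<Rightarrow> 'a" where
  "sc c m = (\<lambda>i l. c * m i l)"

definition fsc :: "(nat \<Rightarrow> 'a) \<Rightarrow> (nat \<Rightarrow> nat \<Rightarrow> 'a) \<Rightarrow> nat \<Rightarrow> nat \<Rightarrow> 'a" where
  "fsc r m = (\<lambda>i. mul r (m i))"

definition subsp :: "(nat \<Rightarrow> nat \<Rightarrow> 'a) set \<Rightarrow> bool" where
  "subsp V \<longleftrightarrow> V \<subseteq> msgs \<and> diff_closed V \<and> (\<forall>c. \<forall>v\<in>V. sc c v \<in> V)"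

definition fsubsp :: "(nat \<Rightarrow> nat \<Rightarrow> 'a) set \<Rightarrow> bool" where
  "fsubsp V \<longleftrightarrow> V \<subseteq> msgs \<and> diff_closed V \<and> (\<forall>r\<in>vecs n. \<forall>v\<in>V. fsc r v \<in> V)"

text \<open>Since \<open>ip\<close> has values in the extension field, this set depends only on the
  \<open>F\<close>-span of \<open>V\<close>, even if \<open>V\<close> is merely an
  F_q-subspace.\<close>

definition perp :: "(nat \<Rightarrow> nat \<Rightarrow> 'a) set \<Rightarrow> (nat \<Rightarrow> nat \<Rightarrow> 'a) set" where
  "perp V = {a\<in>msgs. \<forall>v\<in>V. ip v a = 0}"

section \<open>Arithmetic of messages and of their inner product\<close>

lemma q_ge_2: "2 \<le> q" using two_le_card_field[where 'a = 'a] by simp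

lemma q_pow_ge_2: "2 \<le> q ^ n"
proof -
  have "(2::nat) ^ 1 \<le> 2 ^ n" using n_pos by (intro power_increasing) auto
  also have "\<dots> \<le> q ^ n" using q_ge_2 by (intro power_mono) auto
  finally show ?thesis by simp
qed

lemma card_msgs: "card msgs = (q ^ n) ^ K" and finite_msgs: "finite msgs"
  using card_zero_extended[where k = K and B = "vecs n :: (nat \<Rightarrow> 'a) set"]
  by (simp_all add: msgs_def card_vecs finite_vecs)

lemma msgs_nth: "m \<in> msgs \<Longrightarrow> m i \<in> vecs n"
  by (cases "i < K") (auto simp: msgs_def vecs_closed)

lemma mul_zero: "u \<in> vecs n \<Longrightarrow> mul 0 u = 0" "u \<in> vecs n \<Longrightarrow> mul u 0 = 0"
  using mul_add_left[of 0 0 u] mul_comm[of u 0] by (auto simp: vecs_closed)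

lemma mul_diff_left:
  assumes "u \<in> vecs n" "v \<in> vecs n" "w \<in> vecs n"
  shows "mul (u - v) w = mul u w - mul v w"
  using mul_add_left[of "u - v" v w] assms by (simp add: vecs_closed)

lemma mul_add_right:
  assumes "u \<in> vecs n" "v \<in> vecs n" "w \<in> vecs n"
  shows "mul u (v + w) = mul u v + mul u w"
  using mul_add_left[of v w u] assms by (simp add: vecs_closed mul_comm[of u])

lemma mul_sum_right:
  "r \<in> vecs n \<Longrightarrow> (\<And>i. i \<in> A \<Longrightarrow> f i \<in> vecs n) \<Longrightarrow> mul r (sum f A) = (\<Sum>i\<in>A. mul r (f i))"
  by (induction A rule: infinite_finite_induct) (auto simp: mul_zero mul_add_right sum_vecs)

lemma msgs_diff: "m \<in> msgs \<Longrightarrow> m' \<in> msgs \<Longrightarrow> m - m' \<in> msgs"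
  and msgs_zero: "0 \<in> msgs"
  and msgs_sc: "m \<in> msgs \<Longrightarrow> sc c m \<in> msgs"
  and msgs_fsc: "r \<in> vecs n \<Longrightarrow> m \<in> msgs \<Longrightarrow> fsc r m \<in> msgs"
  by (auto simp: msgs_def vecs_closed sc_def fsc_def mul_closed mul_zero)

lemma fsubsp_msgs: "fsubsp msgs" and subsp_msgs: "subsp msgs"
  by (auto simp: fsubsp_def subsp_def diff_closed_def msgs_diff msgs_zero msgs_sc msgs_fsc)

lemma ip_vecs: "m \<in> msgs \<Longrightarrow> a \<in> msgs \<Longrightarrow> ip m a \<in> vecs n"
  unfolding ip_def by (intro sum_vecs mul_closed msgs_nth)

lemma ip_comm: "m \<in> msgs \<Longrightarrow> a \<in> msgs \<Longrightarrow> ip m a = ip a m"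
  unfolding ip_def by (intro sum.cong refl mul_comm msgs_nth)

lemma ip_diff_left: "m \<in> msgs \<Longrightarrow> m' \<in> msgs \<Longrightarrow> a \<in> msgs \<Longrightarrow> ip (m - m') a = ip m a - ip m' a"
  unfolding ip_def sum_subtractf[symmetric]
  by (intro sum.cong refl) (simp add: mul_diff_left msgs_nth)

lemma ip_diff_right: "m \<in> msgs \<Longrightarrow> m' \<in> msgs \<Longrightarrow> a \<in> msgs \<Longrightarrow> ip a (m - m') = ip a m - ip a m'"
  by (simp add: ip_comm[of a] msgs_diff ip_diff_left)

lemma ip_zero: "a \<in> msgs \<Longrightarrow> ip 0 a = 0" "a \<in> msgs \<Longrightarrow> ip a 0 = 0"
  using ip_diff_left[of 0 0 a] ip_diff_right[of 0 0 a] by (auto simp: msgs_zero)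

lemma ip_sc: "m \<in> msgs \<Longrightarrow> a \<in> msgs \<Longrightarrow> ip (sc c m) a = (\<lambda>l. c * ip m a l)"
  unfolding ip_def by (simp add: sc_def mul_scale_left msgs_nth fun_eq_iff sum_distrib_left
      sum.distrib sum_fun_apply)

lemma ip_fsc_right: "r \<in> vecs n \<Longrightarrow> m \<in> msgs \<Longrightarrow> a \<in> msgs \<Longrightarrow> ip m (fsc r a) = mul r (ip m a)"
proof -
  assume a: "r \<in> vecs n" "m \<in> msgs" "a \<in> msgs"
  have "mul (m i) (mul r (a i)) = mul r (mul (m i) (a i))" for i
    using a mul_assoc[of "m i" r "a i"] mul_assoc[of r "m i" "a i"] mul_comm[of r "m i"]
    by (simp add: msgs_nth)
  then show ?thesis using a by (simp add: ip_def fsc_def mul_sum_right mul_closed msgs_nth)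
qed

text \<open>Division in \<open>F\<close> provides a scalar that turns the one nonzero value
  \<open>ip v x\<close> into any prescribed value, and \<open>X\<close> is closed under such
  scalars.\<close>

lemma ip_onto:
  assumes X: "fsubsp X" and v: "v \<in> msgs" and x: "x \<in> X" "ip v x \<noteq> 0"
  shows "ip v ` X = vecs n"
proof
  have m: "X \<subseteq> msgs" using X by (simp add: fsubsp_def)
  then show "ip v ` X \<subseteq> vecs n" using v by (auto simp: ip_vecs)
  show "vecs n \<subseteq> ip v ` X"
  proof
    fix w :: "nat \<Rightarrow> 'a" assume w: "w \<in> vecs n"
    obtain r where r: "r \<in> vecs n" "mul r (ip v x) = w"
      using mul_onto[OF ip_vecs x(2) w] v x m by blast
    then have "ip v (fsc r x) = w" using v x m by (auto simp: ip_fsc_right)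
    moreover have "fsc r x \<in> X" using X r x by (simp add: fsubsp_def)
    ultimately show "w \<in> ip v ` X" by blast
  qed
qed

lemma ip_nondegenerate:
  assumes "m \<in> msgs" "m \<noteq> 0"
  shows "\<exists>x\<in>msgs. ip m x \<noteq> 0"
proof -
  obtain i where i: "m i \<noteq> 0" using assms(2) by (auto simp: fun_eq_iff)
  then have iK: "i < K" using assms(1) by (auto simp: msgs_def not_less[symmetric])
  \<comment> \<open>Any nonzero target would do; the first unit vector exists because
    \<open>0 < n\<close>.\<close>
  define w :: "nat \<Rightarrow> 'a" where "w = (\<lambda>l. if l = 0 then 1 else 0)"
  have w: "w \<in> vecs n" "w \<noteq> 0" using n_pos by (auto simp: w_def vecs_def fun_eq_iff)
  obtain r where r: "r \<in> vecs n" "mul r (m i) = w"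
    using mul_onto[OF msgs_nth[OF assms(1)] i w(1)] by blast
  let ?x = "\<lambda>j. if j = i then r else 0"
  have "?x \<in> msgs" using r iK by (auto simp: msgs_def vecs_closed)
  moreover have "ip m ?x = (\<Sum>j<K. if j = i then w else 0)"
    unfolding ip_def using r assms(1)
    by (intro sum.cong refl) (auto simp: mul_zero msgs_nth mul_comm[of "m i"])
  ultimately show ?thesis using iK w(2) by (intro bexI[of _ ?x]) (auto simp: sum.delta)
qed

section \<open>Orthogonal complements and their sizes\<close>

lemma fsubsp_perp: "V \<subseteq> msgs \<Longrightarrow> fsubsp (perp V)"
  by (auto simp: fsubsp_def perp_def diff_closed_def msgs_zero msgs_diff ip_zero ip_diff_right
      msgs_fsc ip_fsc_right mul_zero subset_iff)

lemma perp_subset: "perp V \<subseteq> msgs" by (auto simp: perp_def)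

lemma perp_antimono: "W \<subseteq> V \<Longrightarrow> perp V \<subseteq> perp W" by (auto simp: perp_def)

lemma finite_perp: "finite (perp V)" using finite_msgs perp_subset finite_subset by blast

lemma card_perp_pos: "V \<subseteq> msgs \<Longrightarrow> 0 < card (perp V)"
  using fsubsp_perp[of V] finite_perp[of V] by (auto simp: fsubsp_def diff_closed_def card_gt_0_iff)

text \<open>The duality formula applied to \<open>perp V\<close>, whose annihilator
  \<open>perp (perp V)\<close> is the \<open>F\<close>-span of \<open>V\<close>.\<close>

lemma card_perp_biperp: "V \<subseteq> msgs \<Longrightarrow> card (perp V) * card (perp (perp V)) = card msgs"
  unfolding perp_def[of "perp V"]
proof (rule card_annihilator[where Z = "vecs n"])
  assume V: "V \<subseteq> msgs"
  have F: "fsubsp (perp V)" by (rule fsubsp_perp[OF V])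
  show "diff_closed (perp V)" using F by (simp add: fsubsp_def)
  show "2 \<le> card (vecs n :: (nat \<Rightarrow> 'a) set)" using q_pow_ge_2 by (simp add: card_vecs)
  show "ip x ` msgs = vecs n" if "x \<in> perp V" "x \<noteq> 0" for x
    using ip_nondegenerate[of x] ip_onto[OF fsubsp_msgs] that perp_subset by blast
  show "(\<forall>x\<in>perp V. ip x y = 0) \<or> (\<lambda>x. ip x y) ` perp V = vecs n" if "y \<in> msgs" for y
  proof -
    have "ip x y = ip y x" if "x \<in> perp V" for x
      using ip_comm[of x y] \<open>y \<in> msgs\<close> that perp_subset by blast
    then show ?thesis using ip_onto[OF F that] by (auto cong: image_cong_simp)
  qed
qed (use perp_subset in \<open>auto simp: finite_perp finite_msgs ip_diff_left ip_diff_right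
     diff_closed_def msgs_zero msgs_diff subset_iff\<close>)

lemma perp_insert: "perp (insert v V) = {x\<in>perp V. ip v x = 0}"
  by (auto simp: perp_def)

lemma card_ip_kernel:
  assumes X: "fsubsp X" and v: "v \<in> msgs" and "\<exists>x\<in>X. ip v x \<noteq> 0"
  shows "card X = q ^ n * card {x\<in>X. ip v x = 0}"
proof -
  obtain x where "x \<in> X" "ip v x \<noteq> 0" using assms by blast
  then have img: "ip v ` X = vecs n" by (rule ip_onto[OF X v])
  have s: "X \<subseteq> msgs" using X by (simp add: fsubsp_def)
  have "card X = card (ip v ` X) * card {x\<in>X. ip v x = 0}"
  proof (rule card_fibres)
    show "finite X" using s finite_msgs finite_subset by blast
    show "diff_closed X" using X by (simp add: fsubsp_def)
  qed (use s v in \<open>auto simp: ip_diff_right subset_iff\<close>)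
  then show ?thesis by (simp add: img card_vecs)
qed

text \<open>By symmetry of \<open>ip\<close>, the vector \<open>v\<close> lies in
  \<open>perp (perp V)\<close> exactly if its functional is zero on \<open>perp V\<close>. Otherwise
  that functional is onto \<open>F\<close>, and its kernel has index \<open>q ^ n\<close>.\<close>

lemma card_perp_insert:
  assumes "V \<subseteq> msgs" "v \<in> msgs"
  shows "v \<in> perp (perp V) \<Longrightarrow> perp (insert v V) = perp V"
    and "v \<notin> perp (perp V) \<Longrightarrow> card (perp V) = q ^ n * card (perp (insert v V))"
    and "card (perp V) \<le> q ^ n * card (perp (insert v V))"
proof -
  have sym: "ip v x = ip x v" if "x \<in> perp V" for x
    using ip_comm[of x v] assms that perp_subset[of V] by auto
  show a: "perp (insert v V) = perp V" if "v \<in> perp (perp V)"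
    using that sym by (auto simp: perp_insert) (auto simp: perp_def)
  show b: "card (perp V) = q ^ n * card (perp (insert v V))" if "v \<notin> perp (perp V)"
  proof -
    have "\<exists>x\<in>perp V. ip v x \<noteq> 0" using that assms sym by (auto simp: perp_def[of "perp V"])
    then show ?thesis unfolding perp_insert by (rule card_ip_kernel[OF fsubsp_perp[OF assms(1)] assms(2)])
  qed
  show "card (perp V) \<le> q ^ n * card (perp (insert v V))"
    using a b q_pow_ge_2 by (cases "v \<in> perp (perp V)") auto
qed

text \<open>The sections \<open>V \<inter> a\<^sup>\<bottom>\<close> are saturated, so they lose a full factor \<open>q ^ n\<close>.\<close>
lemma card_perp_section:
  assumes V: "V \<subseteq> msgs" and a: "a \<in> msgs" "a \<notin> perp V"
  shows "q ^ n * card (perp V) \<le> card (perp {v\<in>V. ip v a = 0})"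
proof -
  let ?W = "{v\<in>V. ip v a = 0}"
  obtain v where v: "v \<in> V" "ip v a \<noteq> 0" using a by (auto simp: perp_def)
  have W: "?W \<subseteq> msgs" using V by auto
  \<comment> \<open>The column \<open>a\<close> itself lies in \<open>perp ?W\<close> and
    \<open>ip v a\<close> is nonzero, so passing to the kernel of \<open>ip v\<close> divides the
    size by \<open>q ^ n\<close>. That kernel still contains \<open>perp V\<close>.\<close>
  have "card (perp ?W) = q ^ n * card {x\<in>perp ?W. ip v x = 0}"
    using v V a by (intro card_ip_kernel fsubsp_perp W) (auto simp: perp_def)
  moreover have "card (perp V) \<le> card {x\<in>perp ?W. ip v x = 0}"
    using v by (intro card_mono finite_subset[OF _ finite_perp[of ?W]]) (auto simp: perp_def)
  ultimately show ?thesis by simp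
qed

section \<open>Building F_q-subspaces one vector at a time\<close>

lemma sc_diff: "sc c (u - v) = sc c u - sc c v" "sc (c - d) u = sc c u - sc d u"
  "sc c (u + v) = sc c u + sc c v" "sc (c + d) u = sc c u + sc d u"
  by (auto simp: sc_def fun_eq_iff algebra_simps)

lemma sc_simps [simp]: "sc c (sc d v) = sc (c * d) v" "sc 1 v = v" "sc 0 v = 0" "sc c 0 = 0"
  by (auto simp: sc_def fun_eq_iff algebra_simps)

lemma subsp_add: "subsp V \<Longrightarrow> u \<in> V \<Longrightarrow> v \<in> V \<Longrightarrow> u + v \<in> V"
  using diff_closed_add by (auto simp: subsp_def)

lemma subsp_finite: "subsp V \<Longrightarrow> finite V"
  using finite_msgs finite_subset by (auto simp: subsp_def)

lemma subsp_zero: "subsp V \<Longrightarrow> 0 \<in> V"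
  by (auto simp: subsp_def diff_closed_def)

lemma subsp_card_pos: "subsp V \<Longrightarrow> 0 < card V"
  using subsp_finite subsp_zero by (auto simp: card_gt_0_iff)

text \<open>\<open>W'\<close> is \<open>W\<close> plus the F_q-line of \<open>v\<close>. It is the
  least subspace containing both, and the added multiples of \<open>v\<close> impose no further
  orthogonality condition.\<close>

lemma subsp_extend:
  assumes W: "subsp W" and v: "v \<in> msgs" "v \<notin> W"
  obtains W' where "subsp W'" "W \<subseteq> W'" "v \<in> W'" "card W' = q * card W"
    "\<And>V. subsp V \<Longrightarrow> W \<subseteq> V \<Longrightarrow> v \<in> V \<Longrightarrow> W' \<subseteq> V" "perp W' = perp (insert v W)"
proof
  define g where "g = (\<lambda>(w, c). w + sc c v)"
  define W' where "W' = g ` (W \<times> UNIV)"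
  have in_W': "w + sc c v \<in> W'" if "w \<in> W" for w c using that by (force simp: W'_def g_def)
  have m: "W \<subseteq> msgs" using W by (simp add: subsp_def)
  have mplus: "x + y \<in> msgs" if "x \<in> msgs" "y \<in> msgs" for x y using subsp_add[OF subsp_msgs that] .
  show "subsp W'"
    unfolding subsp_def diff_closed_def
  proof (intro conjI ballI allI)
    show "W' \<subseteq> msgs" using m v by (auto simp: W'_def g_def intro!: mplus msgs_sc)
    show "0 \<in> W'" using in_W'[OF subsp_zero[OF W], of 0] by simp
    fix x y assume "x \<in> W'" "y \<in> W'"
    then obtain w c w' c' where xy: "x = w + sc c v" "y = w' + sc c' v" "w \<in> W" "w' \<in> W"
      by (auto simp: W'_def g_def)
    have "x - y = (w - w') + sc (c - c') v" by (simp add: xy sc_diff)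
    also have "\<dots> \<in> W'" using W xy by (intro in_W') (simp add: subsp_def diff_closed_def)
    finally show "x - y \<in> W'" .
    fix d
    have "sc d x = sc d w + sc (d * c) v" by (simp add: xy sc_diff)
    also have "\<dots> \<in> W'" using W xy by (intro in_W') (simp add: subsp_def)
    finally show "sc d x \<in> W'" .
  qed
  show "W \<subseteq> W'" using in_W'[of _ 0] by auto
  show vW': "v \<in> W'" using in_W'[OF subsp_zero[OF W], of 1] by simp
  have "inj_on g (W \<times> UNIV)"
  proof (rule inj_onI, clarsimp simp: g_def)
    fix w c w' c' assume w: "w \<in> W" "w' \<in> W" and eq: "w + sc c v = w' + sc c' v"
    have "c = c'"
    \<comment> \<open>Different coefficients would put a nonzero multiple of \<open>v\<close>, and
      hence \<open>v\<close>, into \<open>W\<close>.\<close>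
    proof (rule ccontr)
      assume "c \<noteq> c'"
      have "sc (c - c') v = w' - w" using eq by (simp add: sc_diff algebra_simps)
      moreover have "w' - w \<in> W" using W w by (simp add: subsp_def diff_closed_def)
      ultimately have "sc (1 / (c - c')) (sc (c - c') v) \<in> W" using W by (simp add: subsp_def)
      then show False using \<open>c \<noteq> c'\<close> v(2) by simp
    qed
    with eq show "w = w' \<and> c = c'" by simp
  qed
  then show "card W' = q * card W" unfolding W'_def by (simp add: card_image card_cartesian_product)
  show "W' \<subseteq> V" if "subsp V" "W \<subseteq> V" "v \<in> V" for V
    using that subsp_add[OF that(1)] by (auto simp: W'_def g_def subsp_def subset_iff)
  show "perp W' = perp (insert v W)"
  proof
    show "perp W' \<subseteq> perp (insert v W)" using \<open>W \<subseteq> W'\<close> vW' by (intro perp_antimono) auto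
    show "perp (insert v W) \<subseteq> perp W'"
    proof
      fix a assume a: "a \<in> perp (insert v W)"
      then have am: "a \<in> msgs" by (simp add: perp_def)
      have "ip (w + sc c v) a = 0" if "w \<in> W" for w c
      proof -
        have "w + sc c v = w - sc (-c) v" by (simp add: sc_def fun_eq_iff)
        moreover have "ip w a = 0" "ip v a = 0" using a that by (auto simp: perp_def)
        ultimately show ?thesis using am v m that
          by (auto simp: ip_diff_left msgs_sc ip_sc subset_iff)
      qed
      then show "a \<in> perp W'" using am by (auto simp: perp_def W'_def g_def)
    qed
  qed
qed

text \<open>Start from the zero space and adjoin vectors of \<open>X\<close>; each one multiplies
  the size by \<open>q\<close>, so a vector remains available until \<open>q ^ k\<close> is
  reached.\<close>

lemma subsp_of_card:
  assumes X: "subsp X" "q ^ k \<le> card X"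
  shows "\<exists>V. subsp V \<and> V \<subseteq> X \<and> card V = q ^ k"
  using X(2)
proof (induction k)
  case 0
  have "subsp {0}" by (auto simp: subsp_def diff_closed_def msgs_zero)
  then show ?case using subsp_zero[OF X(1)] by (intro exI[of _ "{0}"]) auto
next
  case (Suc k)
  have lt: "q ^ k < q ^ Suc k" using q_ge_2 by (intro power_strict_increasing) auto
  with Suc obtain V where V: "subsp V" "V \<subseteq> X" "card V = q ^ k" by auto
  then have "V \<noteq> X" using lt Suc.prems by auto
  then obtain v where v: "v \<in> X" "v \<notin> V" using V by auto
  have "v \<in> msgs" using v X by (auto simp: subsp_def)
  from subsp_extend[OF V(1) this v(2)] obtain W' where "subsp W'" "card W' = q * card V" "W' \<subseteq> X"
    using V v X by metis
  then show ?case using V(3) by (intro exI[of _ W']) auto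
qed

text \<open>Adjoining one vector to \<open>W\<close> multiplies \<open>card W ^ n\<close> by
  \<open>q ^ n\<close> and divides \<open>card (perp W)\<close> by at most \<open>q ^ n\<close>.
  Hence the product cannot decrease along a chain from \<open>W\<close> to \<open>V\<close>.\<close>

lemma card_perp_mono:
  assumes "subsp V" "subsp W" "W \<subseteq> V"
  shows "card (perp W) * card W ^ n \<le> card (perp V) * card V ^ n"
  using assms(2,3)
proof (induction "card V - card W" arbitrary: W rule: less_induct)
  case less
  show ?case
  proof (cases "W = V")
    case False
    then obtain v where v: "v \<in> V" "v \<notin> W" using less.prems by auto
    have vm: "v \<in> msgs" using v assms(1) by (auto simp: subsp_def)
    obtain W' where W': "subsp W'" "W \<subseteq> W'" "card W' = q * card W" "W' \<subseteq> V"
        "perp W' = perp (insert v W)"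
      using subsp_extend[OF less.prems(1) vm v(2)] less.prems(2) v assms(1) by metis
    have "card W < card W'" using W'(3) subsp_card_pos[OF less.prems(1)] q_ge_2 by simp
    moreover have "card W' \<le> card V" using W'(4) subsp_finite[OF assms(1)] by (simp add: card_mono)
    ultimately have "card V - card W' < card V - card W" by linarith
    then have IH: "card (perp W') * card W' ^ n \<le> card (perp V) * card V ^ n"
      by (rule less.hyps[OF _ W'(1,4)])
    have "card (perp W) * card W ^ n \<le> (q ^ n * card (perp W')) * card W ^ n"
      using less.prems(1) vm by (simp add: W'(5) card_perp_insert(3) subsp_def)
    also have "\<dots> = card (perp W') * card W' ^ n" by (simp add: W'(3) power_mult_distrib)
    finally show ?thesis using IH by simp
  qed simp
qed

end

section \<open>Uniform probability\<close>

lemma unif_prob_nonneg: "0 \<le> unif_prob \<Omega> P"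
  by (simp add: unif_prob_def)

lemma unif_prob_mono:
  assumes "finite \<Omega>" "\<And>x. x \<in> \<Omega> \<Longrightarrow> P x \<Longrightarrow> P' x"
  shows "unif_prob \<Omega> P \<le> unif_prob \<Omega> P'"
  unfolding unif_prob_def using assms
  by (intro divide_right_mono of_nat_mono card_mono) auto

lemma unif_prob_disj:
  assumes "finite \<Omega>"
  shows "unif_prob \<Omega> (\<lambda>x. P x \<or> P' x) \<le> unif_prob \<Omega> P + unif_prob \<Omega> P'"
proof -
  have "{x\<in>\<Omega>. P x \<or> P' x} = {x\<in>\<Omega>. P x} \<union> {x\<in>\<Omega>. P' x}" by auto
  then show ?thesis unfolding unif_prob_def add_divide_distrib[symmetric]
    using card_Un_le[of "{x\<in>\<Omega>. P x}" "{x\<in>\<Omega>. P' x}"]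
    by (intro divide_right_mono) (simp_all flip: of_nat_add)
qed

lemma unif_prob_Bex:
  assumes "finite I"
  shows "unif_prob \<Omega> (\<lambda>x. \<exists>i\<in>I. P i x) \<le> (\<Sum>i\<in>I. unif_prob \<Omega> (P i))"
proof -
  have "{x\<in>\<Omega>. \<exists>i\<in>I. P i x} = (\<Union>i\<in>I. {x\<in>\<Omega>. P i x})" by auto
  then show ?thesis unfolding unif_prob_def sum_divide_distrib[symmetric]
    using card_UN_le[OF assms, of "\<lambda>i. {x\<in>\<Omega>. P i x}"]
    by (intro divide_right_mono) (simp_all flip: of_nat_sum)
qed

lemma unif_prob_ge:
  assumes "finite \<Omega>" "\<Omega> \<noteq> {}" "\<And>x. x \<in> \<Omega> \<Longrightarrow> \<not> P x \<Longrightarrow> P' x" "unif_prob \<Omega> P' \<le> r"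
  shows "1 - r \<le> unif_prob \<Omega> P"
proof -
  have "1 = unif_prob \<Omega> (\<lambda>x. P x \<or> \<not> P x)" using assms by (simp add: unif_prob_def)
  also have "\<dots> \<le> unif_prob \<Omega> P + unif_prob \<Omega> (\<lambda>x. \<not> P x)" by (rule unif_prob_disj[OF assms(1)])
  also have "unif_prob \<Omega> (\<lambda>x. \<not> P x) \<le> unif_prob \<Omega> P'" using assms by (intro unif_prob_mono) auto
  finally show ?thesis using assms(4) by linarith
qed

lemma unif_prob_bij:
  assumes "bij_betw \<phi> \<Omega> \<Omega>'"
  shows "unif_prob \<Omega> (\<lambda>x. P (\<phi> x)) = unif_prob \<Omega>' P"
proof -
  have "bij_betw \<phi> {x\<in>\<Omega>. P (\<phi> x)} {x\<in>\<Omega>'. P x}"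
    using assms by (auto simp: bij_betw_def inj_on_def)
  then show ?thesis using bij_betw_same_card[OF assms] bij_betw_same_card
    by (fastforce simp: unif_prob_def)
qed

lemma unif_prob_Times:
  assumes "finite A" "finite B"
  shows "unif_prob (A \<times> B) P = (\<Sum>a\<in>A. unif_prob B (\<lambda>b. P (a, b))) / card A"
proof -
  have "{x\<in>A \<times> B. P x} = (SIGMA a:A. {b\<in>B. P (a, b)})" by auto
  then have "card {x\<in>A \<times> B. P x} = (\<Sum>a\<in>A. card {b\<in>B. P (a, b)})" using assms by simp
  then show ?thesis
    by (simp add: unif_prob_def sum_divide_distrib[symmetric] card_cartesian_product)
qed

lemma unif_prob_PiE:
  "unif_prob ({..<N::nat} \<rightarrow>\<^sub>E \<Omega>) (\<lambda>\<omega>. \<forall>j<N. E j (\<omega> j)) = (\<Prod>j<N. unif_prob \<Omega> (E j))"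
proof -
  have "{\<omega> \<in> {..<N} \<rightarrow>\<^sub>E \<Omega>. \<forall>j<N. E j (\<omega> j)} = PiE {..<N} (\<lambda>j. {x\<in>\<Omega>. E j x})"
    by (auto simp: PiE_def Pi_def)
  then show ?thesis by (simp add: unif_prob_def card_PiE prod_dividef)
qed

section \<open>Estimates for a single block\<close>

context coord_field
begin

text \<open>The inverse of \<open>orth_prob V\<close> is the size of the \<open>F\<close>-span of \<open>V\<close>.\<close>
definition orth_prob :: "(nat \<Rightarrow> nat \<Rightarrow> 'a) set \<Rightarrow> real" where
  "orth_prob V = card (perp V) / card msgs"

lemma card_msgs_pos: "0 < card msgs"
  using finite_msgs msgs_zero by (auto simp: card_gt_0_iff)

lemma orth_prob_pos: "V \<subseteq> msgs \<Longrightarrow> 0 < orth_prob V"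
  using card_perp_pos card_msgs_pos by (simp add: orth_prob_def)

lemma orth_prob_nonneg [simp]: "0 \<le> orth_prob V"
  by (simp add: orth_prob_def)

lemma orth_prob_le_1: "orth_prob V \<le> 1"
  using card_mono[OF finite_msgs perp_subset[of V]] card_msgs_pos by (simp add: orth_prob_def)

lemma orth_prob_antimono: "W \<subseteq> V \<Longrightarrow> orth_prob V \<le> orth_prob W"
  unfolding orth_prob_def
  by (intro divide_right_mono of_nat_mono card_mono finite_perp perp_antimono) auto

lemma orth_prob_insert:
  assumes "V \<subseteq> msgs" "v \<in> msgs"
  shows "v \<in> perp (perp V) \<Longrightarrow> orth_prob (insert v V) = orth_prob V"
    and "v \<notin> perp (perp V) \<Longrightarrow> orth_prob (insert v V) = orth_prob V / q ^ n"
    and "orth_prob V \<le> q ^ n * orth_prob (insert v V)"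
proof -
  show "orth_prob (insert v V) = orth_prob V" if "v \<in> perp (perp V)"
    using card_perp_insert(1)[OF assms that] by (simp add: orth_prob_def)
  show "orth_prob (insert v V) = orth_prob V / q ^ n" if "v \<notin> perp (perp V)"
    using card_perp_insert(2)[OF assms that] q_ge_2 by (simp add: orth_prob_def)
  have "real (card (perp V)) \<le> real (q ^ n * card (perp (insert v V)))"
    using card_perp_insert(3)[OF assms] of_nat_le_iff by blast
  then show "orth_prob V \<le> q ^ n * orth_prob (insert v V)"
    by (simp add: orth_prob_def divide_right_mono)
qed

text \<open>The \<open>F\<close>-line of one nonzero vector already has \<open>q ^ n\<close>
  elements: nondegeneracy keeps \<open>v\<close> out of the span of the empty set.\<close>

lemma orth_prob_nonzero:
  assumes "V \<subseteq> msgs" "v \<in> V" "v \<noteq> 0"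
  shows "orth_prob V \<le> 1 / q ^ n"
proof -
  have v: "v \<in> msgs" using assms by auto
  have "perp {} = msgs" by (auto simp: perp_def)
  moreover have "v \<notin> perp msgs"
    using ip_nondegenerate[OF v assms(3)] v by (auto simp: perp_def ip_comm[of v])
  ultimately have "orth_prob {v} = 1 / q ^ n"
    using orth_prob_insert(2)[of "{}" v] v card_msgs_pos by (simp add: orth_prob_def)
  then show ?thesis using orth_prob_antimono[of "{v}" V] assms by simp
qed

lemma orth_prob_section:
  assumes "V \<subseteq> msgs" "a \<in> msgs" "a \<notin> perp V"
  shows "q ^ n * orth_prob V \<le> orth_prob {v\<in>V. ip v a = 0}"
proof -
  have "real (q ^ n * card (perp V)) \<le> real (card (perp {v\<in>V. ip v a = 0}))"
    using card_perp_section[OF assms] of_nat_le_iff by blast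
  then show ?thesis by (simp add: orth_prob_def divide_right_mono)
qed

lemma card_biperp: "V \<subseteq> msgs \<Longrightarrow> card (perp (perp V)) = 1 / orth_prob V"
  using card_perp_biperp[of V] card_perp_pos[of V]
  by (simp add: orth_prob_def field_simps flip: of_nat_mult)

lemma subsp_section: "subsp V \<Longrightarrow> a \<in> msgs \<Longrightarrow> subsp {v\<in>V. ip v a = 0}"
  by (auto simp: subsp_def diff_closed_def ip_zero ip_diff_left ip_sc subset_iff fun_eq_iff)

section \<open>Probability of vanishing within one block\<close>

definition mats :: "(nat \<Rightarrow> nat \<Rightarrow> 'a) set" where
  "mats = {..<n} \<rightarrow>\<^sub>E vecs n"

text \<open>A block consists of an outer column \<open>a\<close> and an inner matrix stored by
  columns. Position \<open>k\<close> of the codeword of \<open>v\<close> is then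
  \<open>dot n (ip v a) (H k)\<close>.\<close>

definition vanish :: "(nat \<Rightarrow> nat \<Rightarrow> 'a) set \<Rightarrow> nat set \<Rightarrow> (nat \<Rightarrow> nat \<Rightarrow> 'a) \<times> (nat \<Rightarrow> nat \<Rightarrow> 'a) \<Rightarrow> bool" where
  "vanish V S = (\<lambda>(a, H). \<forall>v\<in>V. \<forall>k\<in>S. dot n (ip v a) (H k) = 0)"

lemma finite_mats: "finite mats"
  by (simp add: mats_def finite_PiE finite_vecs)

lemma mats_nonempty: "mats \<noteq> {}"
  using vecs_closed(1) by (auto simp: mats_def PiE_eq_empty_iff)

text \<open>For fixed \<open>a\<close>, each column \<open>H k\<close> with \<open>k\<close> in
  \<open>S\<close> must annihilate the F_q-space \<open>U\<close> of values \<open>ip v a\<close>.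
  By duality this has probability \<open>1 / card U\<close>, the columns are independent, and
  \<open>card V / card U\<close> is the size of the kernel.\<close>

lemma unif_prob_mats_vanish:
  assumes V: "subsp V" and a: "a \<in> msgs" and S: "S \<subseteq> {..<n}"
  shows "unif_prob mats (\<lambda>H. vanish V S (a, H)) = (real (card {v\<in>V. ip v a = 0}) / card V) ^ card S"
proof -
  define U where "U = (\<lambda>v. ip v a) ` V"
  define A where "A = {g\<in>vecs n. \<forall>u\<in>U. dot n u g = 0}"
  have Vm: "V \<subseteq> msgs" using V by (simp add: subsp_def)
  have UA: "card U * card A = q ^ n"
    unfolding A_def card_UNIV_eq[symmetric]
  proof (rule card_dot_annihilator)
    show "U \<subseteq> vecs n" using Vm a by (auto simp: U_def ip_vecs)
    have "ip u a - ip v a \<in> U" if "u \<in> V" "v \<in> V" for u v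
    proof -
      have "u - v \<in> V" using V that by (simp add: subsp_def diff_closed_def)
      then have "ip (u - v) a \<in> U" by (simp add: U_def)
      then show ?thesis using that Vm a by (simp add: ip_diff_left subset_iff)
    qed
    moreover have "0 \<in> U" using subsp_zero[OF V] ip_zero(1)[OF a] unfolding U_def by (metis imageI)
    ultimately show "diff_closed U" by (auto simp: diff_closed_def U_def)
    show "(\<lambda>l. c * u l) \<in> U" if "u \<in> U" for c u
    proof -
      from that obtain v where v: "v \<in> V" "u = ip v a" by (auto simp: U_def)
      then have "sc c v \<in> V" using V by (simp add: subsp_def)
      then have "ip (sc c v) a \<in> U" by (simp add: U_def)
      then show ?thesis using v Vm a by (simp add: ip_sc subset_iff)
    qed
  qed
  have UZ: "card V = card U * card {v\<in>V. ip v a = 0}"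
    unfolding U_def
  proof (rule card_fibres)
    show "finite V" by (rule subsp_finite[OF V])
    show "diff_closed V" using V by (simp add: subsp_def)
  qed (use Vm a in \<open>auto simp: ip_diff_left subset_iff\<close>)
  have "card A \<noteq> 0" "card {v\<in>V. ip v a = 0} \<noteq> 0"
    using UA UZ subsp_card_pos[OF V] q_ge_2 by (intro notI; simp)+
  then have "real (card {v\<in>V. ip v a = 0}) / card V = card A / real (q ^ n)"
    unfolding UZ UA[symmetric] by simp
  moreover have "unif_prob mats (\<lambda>H. vanish V S (a, H)) = (card A / real (q ^ n)) ^ card S"
  proof -
    have "{H\<in>mats. vanish V S (a, H)} = PiE {..<n} (\<lambda>k. if k \<in> S then A else vecs n)"
      using S by (auto simp: mats_def vanish_def A_def U_def PiE_iff extensional_def split: if_splits)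
    then have "card {H\<in>mats. vanish V S (a, H)} = card A ^ card S * (q ^ n) ^ (n - card S)"
      using S by (simp add: card_PiE if_distrib prod.If_cases Int_absorb1 Diff_eq[symmetric]
          card_Diff_subset finite_subset[OF S] card_vecs)
    moreover have "card mats = (q ^ n) ^ card S * (q ^ n) ^ (n - card S)"
      using card_mono[OF _ S] by (simp add: mats_def card_funcsetE card_vecs flip: power_add)
    ultimately show ?thesis using q_ge_2 by (simp add: unif_prob_def power_divide)
  qed
  ultimately show ?thesis by simp
qed

text \<open>Group the columns by their section \<open>W\<close> of \<open>V\<close>. There are at
  most \<open>2 ^ card V\<close> sections, and the columns with section \<open>W\<close> all lie in
  \<open>perp W\<close>, a fraction \<open>orth_prob W\<close> of all columns.\<close>

lemma sum_sections_le:
  fixes \<beta> :: real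
  assumes V: "subsp V" and U: "U \<subseteq> msgs" and "0 \<le> \<beta>"
    and \<beta>: "\<And>a. a \<in> U \<Longrightarrow>
      orth_prob {v\<in>V. ip v a = 0} * (real (card {v\<in>V. ip v a = 0}) / card V) ^ s \<le> \<beta>"
  shows "(\<Sum>a\<in>U. (real (card {v\<in>V. ip v a = 0}) / card V) ^ s) \<le> card msgs * (2 ^ card V * \<beta>)"
proof -
  define Z where "Z = (\<lambda>a. {v\<in>V. ip v a = 0})"
  define x where "x = (\<lambda>W :: (nat \<Rightarrow> nat \<Rightarrow> 'a) set. (real (card W) / card V) ^ s)"
  have finV: "finite V" by (rule subsp_finite[OF V])
  have finU: "finite U" using U finite_msgs finite_subset by blast
  have "(\<Sum>a\<in>U. x (Z a)) = (\<Sum>W\<in>Z ` U. \<Sum>a | a \<in> U \<and> Z a = W. x (Z a))"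
    by (rule sum.image_gen[OF finU])
  also have "\<dots> \<le> (\<Sum>W\<in>Z ` U. card msgs * \<beta>)"
  proof (rule sum_mono)
    fix W assume W: "W \<in> Z ` U"
    have "(\<Sum>a | a \<in> U \<and> Z a = W. x (Z a)) = card {a. a \<in> U \<and> Z a = W} * x W" by simp
    also have "\<dots> \<le> card (perp W) * x W"
      using U by (intro mult_right_mono of_nat_mono card_mono finite_perp)
        (auto simp: perp_def Z_def x_def)
    also have "\<dots> = card msgs * (orth_prob W * x W)"
      using card_msgs_pos by (simp add: orth_prob_def)
    also have "\<dots> \<le> card msgs * \<beta>"
      using W \<beta> by (intro mult_left_mono) (auto simp: Z_def x_def)
    finally show "(\<Sum>a | a \<in> U \<and> Z a = W. x (Z a)) \<le> card msgs * \<beta>" .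
  qed
  also have "\<dots> = card (Z ` U) * (card msgs * \<beta>)" by simp
  also have "\<dots> \<le> card (Pow V) * (card msgs * \<beta>)"
    using finV \<open>0 \<le> \<beta>\<close> by (intro mult_right_mono of_nat_mono card_mono) (auto simp: Z_def)
  also have "\<dots> = card msgs * (2 ^ card V * \<beta>)" using finV by (simp add: card_Pow)
  finally show ?thesis by (simp add: Z_def x_def)
qed

text \<open>Raise the inequality of \<open>card_perp_mono\<close> to the power \<open>s / n\<close>.
  What remains is \<open>orth_prob W powr (1 - s / n)\<close>, which is at most 1 because
  \<open>s \<le> n\<close>.\<close>

lemma section_power_le:
  assumes V: "subsp V" and W: "subsp W" "W \<subseteq> V" and s: "s \<le> n"
  shows "orth_prob W * (real (card W) / card V) ^ s \<le> orth_prob V powr (s / n)"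
proof -
  have m: "V \<subseteq> msgs" "W \<subseteq> msgs" using V W by (auto simp: subsp_def)
  note pos = orth_prob_pos[OF m(1)] orth_prob_pos[OF m(2)] subsp_card_pos[OF V] subsp_card_pos[OF W(1)]
  define x where "x = real (card W) / card V"
  have x: "0 < x" using pos by (simp add: x_def)
  have "real (card (perp W) * card W ^ n) \<le> real (card (perp V) * card V ^ n)"
    using card_perp_mono[OF V W] of_nat_le_iff by blast
  then have "orth_prob W * card W ^ n \<le> orth_prob V * card V ^ n"
    by (simp add: orth_prob_def divide_right_mono)
  then have "x ^ n \<le> orth_prob V / orth_prob W"
    using pos by (simp add: x_def power_divide field_simps)
  then have "(x ^ n) powr (s / n) \<le> (orth_prob V / orth_prob W) powr (s / n)"
    using x by (intro powr_mono2) auto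
  moreover have "(x ^ n) powr (s / n) = x ^ s"
    using x n_pos by (simp add: powr_powr flip: powr_realpow)
  ultimately have "orth_prob W * x ^ s \<le> orth_prob W * (orth_prob V / orth_prob W) powr (s / n)"
    using pos by (intro mult_left_mono) auto
  also have "\<dots> = orth_prob V powr (s / n) * orth_prob W powr (1 - s / n)"
    using pos by (simp add: powr_divide powr_diff)
  also have "\<dots> \<le> orth_prob V powr (s / n) * 1"
    using pos orth_prob_le_1[of W] s n_pos by (intro mult_left_mono powr_le1) auto
  finally show ?thesis by (simp add: x_def)
qed

lemma block_prob_le:
  assumes V: "subsp V" and S: "S \<subseteq> {..<n}"
  shows "unif_prob (msgs \<times> mats) (vanish V S) \<le> 2 ^ card V * orth_prob V powr (card S / n)"
proof -
  have "(\<Sum>a\<in>msgs. unif_prob mats (\<lambda>H. vanish V S (a, H))) =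
      (\<Sum>a\<in>msgs. (real (card {v\<in>V. ip v a = 0}) / card V) ^ card S)"
    using V S by (intro sum.cong unif_prob_mats_vanish) auto
  also have "\<dots> \<le> card msgs * (2 ^ card V * orth_prob V powr (card S / n))"
    using V card_mono[OF _ S]
    by (intro sum_sections_le section_power_le subsp_section) auto
  finally show ?thesis
    using card_msgs_pos by (simp add: unif_prob_Times finite_msgs finite_mats field_simps)
qed

text \<open>To base \<open>q\<close>, the logarithm of the compared weight is the F_q-dimension of
  \<open>W\<close> minus \<open>l\<close> times the \<open>F\<close>-dimension of its span. A
  critical space has the largest weight among its own subspaces.\<close>

definition critical :: "real \<Rightarrow> (nat \<Rightarrow> nat \<Rightarrow> 'a) set \<Rightarrow> bool" where
  "critical l V \<longleftrightarrow> (\<forall>W. subsp W \<longrightarrow> W \<subseteq> V \<longrightarrow>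
     card W * orth_prob W powr (l / n) \<le> card V * orth_prob V powr (l / n))"

text \<open>Let \<open>x\<close> be the ratio of sizes and \<open>y\<close> the ratio of
  orthogonality probabilities. Criticality gives \<open>x \<le> y powr (l / n)\<close>, and the
  hypothesis on \<open>s\<close> then yields \<open>x ^ s \<le> y ^ 2\<close>. One factor
  \<open>y\<close> turns \<open>orth_prob W\<close> into \<open>orth_prob V\<close>; the other is at
  most \<open>1 / q ^ n\<close> because a proper section is saturated.\<close>

lemma critical_section_power_le:
  fixes l :: real
  assumes V: "subsp V" "critical l V" and a: "a \<in> msgs" "a \<notin> perp V" and s: "2 * n \<le> l * s"
  shows "orth_prob {v\<in>V. ip v a = 0} * (real (card {v\<in>V. ip v a = 0}) / card V) ^ s
    \<le> orth_prob V / q ^ n"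
proof -
  define W where "W = {v\<in>V. ip v a = 0}"
  have W: "subsp W" "W \<subseteq> V" using subsp_section[OF V(1) a(1)] by (auto simp: W_def)
  have m: "V \<subseteq> msgs" "W \<subseteq> msgs" using V W by (auto simp: subsp_def)
  note pos = orth_prob_pos[OF m(1)] orth_prob_pos[OF m(2)] subsp_card_pos[OF V(1)] subsp_card_pos[OF W(1)]
  define x y where "x = real (card W) / card V" and "y = orth_prob V / orth_prob W"
  have x: "0 < x" and y: "0 < y" using pos by (auto simp: x_def y_def)
  have "q ^ n * orth_prob V \<le> orth_prob W"
    unfolding W_def by (rule orth_prob_section[OF m(1) a])
  then have yq: "y \<le> 1 / q ^ n" using pos q_pow_ge_2 q_ge_2 by (simp add: y_def field_simps)
  have y1: "y \<le> 1" using orth_prob_antimono[OF W(2)] pos by (simp add: y_def)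
  have "card W * orth_prob W powr (l / n) \<le> card V * orth_prob V powr (l / n)"
    using V(2) W by (simp add: critical_def)
  then have "x \<le> y powr (l / n)" using pos by (simp add: x_def y_def powr_divide field_simps)
  then have "x ^ s \<le> (y powr (l / n)) ^ s" using x by (intro power_mono) auto
  also have "\<dots> = y powr (l * s / n)" using y by (simp add: powr_powr flip: powr_realpow)
  also have "\<dots> \<le> y powr 2" using y y1 s n_pos by (intro powr_mono') (auto simp: field_simps)
  also have "\<dots> = y ^ 2" using y by (simp flip: powr_numeral)
  finally have "orth_prob W * x ^ s \<le> orth_prob W * y ^ 2" using pos by (intro mult_left_mono) auto
  also have "\<dots> = orth_prob V * y" using pos by (simp add: y_def power2_eq_square)
  also have "\<dots> \<le> orth_prob V * (1 / q ^ n)" using yq pos by (intro mult_left_mono) auto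
  finally show ?thesis by (simp add: W_def x_def)
qed

text \<open>Either the column is orthogonal to \<open>V\<close>, which has probability
  \<open>orth_prob V\<close>, or the section is proper. In the second case the gain
  \<open>1 / q ^ n\<close> pays for the at most \<open>2 ^ n\<close> choices of
  \<open>S\<close>.\<close>

lemma critical_block_prob_le:
  fixes l :: real
  assumes V: "subsp V" "critical l V" and "0 < l"
  shows "unif_prob (msgs \<times> mats) (\<lambda>x. \<exists>S. S \<subseteq> {..<n} \<and> 2 * n \<le> l * card S \<and> vanish V S x)
    \<le> 2 ^ (card V + 1) * orth_prob V"
proof -
  define \<S> where "\<S> = {S. S \<subseteq> {..<n} \<and> 2 * n \<le> l * card S}"
  have fin\<S>: "finite \<S>" and card\<S>: "card \<S> \<le> 2 ^ n"
  proof -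
    have "\<S> \<subseteq> Pow {..<n}" by (auto simp: \<S>_def)
    then show "finite \<S>" "card \<S> \<le> 2 ^ n"
      using finite_subset card_mono[of "Pow {..<n}" \<S>] by (auto simp: card_Pow)
  qed
  have fin: "finite (msgs \<times> mats)" by (simp add: finite_msgs finite_mats)
  have m: "V \<subseteq> msgs" using V by (simp add: subsp_def)
  have sub: "unif_prob (msgs \<times> mats) (\<lambda>x. fst x \<notin> perp V \<and> vanish V S x)
      \<le> 2 ^ card V * (orth_prob V / q ^ n)" if "S \<in> \<S>" for S
  proof -
    have S: "S \<subseteq> {..<n}" "2 * n \<le> l * card S" using that by (auto simp: \<S>_def)
    have "(\<Sum>a\<in>msgs. unif_prob mats (\<lambda>H. a \<notin> perp V \<and> vanish V S (a, H))) =
        (\<Sum>a\<in>msgs - perp V. (real (card {v\<in>V. ip v a = 0}) / card V) ^ card S)"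
    proof (rule sum.mono_neutral_cong_right)
      show "\<forall>a\<in>msgs - (msgs - perp V). unif_prob mats (\<lambda>H. a \<notin> perp V \<and> vanish V S (a, H)) = 0"
        by (auto simp: unif_prob_def)
    qed (use V S in \<open>auto simp: finite_msgs unif_prob_mats_vanish\<close>)
    also have "\<dots> \<le> card msgs * (2 ^ card V * (orth_prob V / q ^ n))"
      using V S orth_prob_pos[OF m] by (intro sum_sections_le critical_section_power_le[of _ l]) auto
    finally show ?thesis
      using card_msgs_pos by (simp add: unif_prob_Times finite_msgs finite_mats field_simps)
  qed
  have "(\<Sum>a\<in>msgs. unif_prob mats (\<lambda>H. a \<in> perp V)) = (\<Sum>a\<in>perp V. 1)"
    using perp_subset mats_nonempty
    by (intro sum.mono_neutral_cong_right) (auto simp: finite_msgs unif_prob_def finite_mats)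
  then have main: "unif_prob (msgs \<times> mats) (\<lambda>x. fst x \<in> perp V) = orth_prob V"
    by (simp add: unif_prob_Times finite_msgs finite_mats orth_prob_def)
  have "unif_prob (msgs \<times> mats) (\<lambda>x. \<exists>S. S \<subseteq> {..<n} \<and> 2 * n \<le> l * card S \<and> vanish V S x) \<le>
     unif_prob (msgs \<times> mats) (\<lambda>x. fst x \<in> perp V \<or> (\<exists>S\<in>\<S>. fst x \<notin> perp V \<and> vanish V S x))"
    by (rule unif_prob_mono[OF fin]) (auto simp: \<S>_def)
  also have "\<dots> \<le> unif_prob (msgs \<times> mats) (\<lambda>x. fst x \<in> perp V)
     + unif_prob (msgs \<times> mats) (\<lambda>x. \<exists>S\<in>\<S>. fst x \<notin> perp V \<and> vanish V S x)"
    by (rule unif_prob_disj[OF fin])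
  also have "\<dots> \<le> orth_prob V + (\<Sum>S\<in>\<S>. unif_prob (msgs \<times> mats) (\<lambda>x. fst x \<notin> perp V \<and> vanish V S x))"
    unfolding main by (intro add_left_mono unif_prob_Bex fin\<S>)
  also have "(\<Sum>S\<in>\<S>. unif_prob (msgs \<times> mats) (\<lambda>x. fst x \<notin> perp V \<and> vanish V S x))
      \<le> card \<S> * (2 ^ card V * (orth_prob V / q ^ n))"
    using sum_mono[OF sub] by simp
  also have "\<dots> \<le> q ^ n * (2 ^ card V * (orth_prob V / q ^ n))"
  proof (rule mult_right_mono)
    have "card \<S> \<le> q ^ n" using card\<S> power_mono[OF q_ge_2, of n] by linarith
    then show "real (card \<S>) \<le> real (q ^ n)" by (rule of_nat_mono)
  qed (use orth_prob_pos[OF m] in auto)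
  also have "\<dots> = 2 ^ card V * orth_prob V" using q_ge_2 by simp
  also have "orth_prob V + 2 ^ card V * orth_prob V \<le> 2 ^ (card V + 1) * orth_prob V"
    using orth_prob_pos[OF m] mult_right_mono[of 1 "2 ^ card V" "orth_prob V"] by simp
  finally show ?thesis by simp
qed

section \<open>Weighted counting of small message sets\<close>

lemma orth_prob_list_ge: "set xs \<subseteq> msgs \<Longrightarrow> 1 / orth_prob (set xs) \<le> (q ^ n) ^ length xs"
proof (induction xs)
  case Nil
  have "perp {} = msgs" by (auto simp: perp_def)
  then show ?case using card_msgs_pos by (simp add: orth_prob_def)
next
  case (Cons x xs)
  have "set xs \<subseteq> msgs" "x \<in> msgs" using Cons by auto
  note pos = orth_prob_pos[OF this(1)] orth_prob_pos[OF Cons.prems] orth_prob_insert(3)[OF this]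
  have "1 / orth_prob (set (x # xs)) \<le> q ^ n * (1 / orth_prob (set xs))"
    using pos by (simp add: field_simps)
  also have "\<dots> \<le> q ^ n * real ((q ^ n) ^ length xs)"
    using Cons by (intro mult_left_mono) auto
  finally show ?case by simp
qed

text \<open>The \<open>1 / orth_prob V\<close> vectors of the \<open>F\<close>-span leave the
  probability unchanged. All others divide it by \<open>q ^ n\<close>, and the \<open>K\<close>-th
  power of this gain cancels the \<open>(q ^ n) ^ K\<close> vectors to choose from.\<close>

lemma sum_orth_prob_insert_le:
  assumes V: "V \<subseteq> msgs"
  shows "(\<Sum>v\<in>msgs. orth_prob (insert v V) ^ K) \<le> orth_prob V ^ K * (1 / orth_prob V + 1)"
proof -
  let ?P = "perp (perp V)"
  have P: "?P \<subseteq> msgs" by (rule perp_subset)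
  have "(\<Sum>v\<in>msgs. orth_prob (insert v V) ^ K) =
      (\<Sum>v\<in>msgs - ?P. orth_prob (insert v V) ^ K) + (\<Sum>v\<in>?P. orth_prob (insert v V) ^ K)"
    by (rule sum.subset_diff[OF P finite_msgs])
  also have "(\<Sum>v\<in>?P. orth_prob (insert v V) ^ K) = (\<Sum>v\<in>?P. orth_prob V ^ K)"
    using P V by (intro sum.cong) (auto simp: orth_prob_insert(1))
  also have "\<dots> = (1 / orth_prob V) * orth_prob V ^ K" by (simp add: card_biperp[OF V])
  also have "(\<Sum>v\<in>msgs - ?P. orth_prob (insert v V) ^ K) = (\<Sum>v\<in>msgs - ?P. (orth_prob V / q ^ n) ^ K)"
    using V by (intro sum.cong) (auto simp: orth_prob_insert(2))
  also have "\<dots> \<le> (\<Sum>v\<in>msgs. (orth_prob V / q ^ n) ^ K)"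
    using orth_prob_pos[OF V] by (intro sum_mono2) (auto simp: finite_msgs)
  also have "\<dots> = orth_prob V ^ K" using q_ge_2 by (simp add: card_msgs power_divide)
  finally show ?thesis by (simp add: algebra_simps)
qed

text \<open>Each added vector costs at most \<open>1 / orth_prob (set xs) + 1\<close>, and a span of
  at most \<open>B\<close> vectors has at most \<open>(q ^ n) ^ B\<close> elements. The bound is
  thus independent of \<open>K\<close>, whereas the number of lists is not.\<close>

lemma sum_orth_prob_lists_le:
  "k \<le> B \<Longrightarrow> (\<Sum>xs | set xs \<subseteq> msgs \<and> length xs = k. orth_prob (set xs) ^ K) \<le> (real ((q ^ n) ^ B) + 1) ^ k"
proof (induction k)
  case 0
  have "{xs. set xs \<subseteq> msgs \<and> length xs = 0} = {[]}" by auto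
  then show ?case using orth_prob_le_1[of "{}"] orth_prob_pos[of "{}"] by (simp add: power_le_one)
next
  case (Suc k)
  define L where "L = {xs. set xs \<subseteq> msgs \<and> length xs = k}"
  have "{xs. set xs \<subseteq> msgs \<and> length xs = Suc k} = (\<lambda>(xs, v). v # xs) ` (L \<times> msgs)"
    by (auto simp: L_def length_Suc_conv image_iff)
  moreover have "inj_on (\<lambda>(xs, v). v # xs) (L \<times> msgs)" by (auto simp: inj_on_def)
  ultimately have "(\<Sum>xs | set xs \<subseteq> msgs \<and> length xs = Suc k. orth_prob (set xs) ^ K) =
      (\<Sum>(xs, v)\<in>L \<times> msgs. orth_prob (insert v (set xs)) ^ K)"
    by (simp add: sum.reindex case_prod_unfold comp_def)
  also have "\<dots> = (\<Sum>xs\<in>L. \<Sum>v\<in>msgs. orth_prob (insert v (set xs)) ^ K)"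
    by (simp add: sum.cartesian_product)
  also have "\<dots> \<le> (\<Sum>xs\<in>L. orth_prob (set xs) ^ K * (real ((q ^ n) ^ B) + 1))"
  proof (rule sum_mono)
    fix xs assume "xs \<in> L"
    then have xs: "set xs \<subseteq> msgs" "length xs = k" by (auto simp: L_def)
    have "1 / orth_prob (set xs) \<le> (q ^ n) ^ k" using orth_prob_list_ge[OF xs(1)] xs(2) by simp
    also have "(q ^ n) ^ k \<le> (q ^ n) ^ B"
      using Suc.prems q_pow_ge_2 by (intro power_increasing) auto
    then have "real ((q ^ n) ^ k) \<le> real ((q ^ n) ^ B)" by (rule of_nat_mono)
    finally have "orth_prob (set xs) ^ K * (1 / orth_prob (set xs) + 1)
        \<le> orth_prob (set xs) ^ K * (real ((q ^ n) ^ B) + 1)"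
      using orth_prob_pos[OF xs(1)] by (intro mult_left_mono) auto
    then show "(\<Sum>v\<in>msgs. orth_prob (insert v (set xs)) ^ K)
        \<le> orth_prob (set xs) ^ K * (real ((q ^ n) ^ B) + 1)"
      using sum_orth_prob_insert_le[OF xs(1)] by linarith
  qed
  also have "\<dots> = (\<Sum>xs\<in>L. orth_prob (set xs) ^ K) * (real ((q ^ n) ^ B) + 1)"
    by (simp add: sum_distrib_right)
  also have "\<dots> \<le> (real ((q ^ n) ^ B) + 1) ^ k * (real ((q ^ n) ^ B) + 1)"
    using Suc by (intro mult_right_mono) (auto simp: L_def)
  finally show ?case by (simp add: mult.commute)
qed

text \<open>Each such set is the range of a list of length exactly \<open>B\<close>: enumerate it
  and pad with its first element, which exists since the set is nonempty.\<close>

lemma sum_orth_prob_sets_le: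
  assumes "\<And>V. V \<in> \<V> \<Longrightarrow> V \<subseteq> msgs \<and> V \<noteq> {} \<and> card V \<le> B"
  shows "(\<Sum>V\<in>\<V>. orth_prob V ^ K) \<le> (real ((q ^ n) ^ B) + 1) ^ B"
proof -
  let ?L = "{xs. set xs \<subseteq> msgs \<and> length xs = B}"
  have finL: "finite ?L" by (rule finite_lists_length_eq[OF finite_msgs])
  have "\<V> \<subseteq> set ` ?L"
  proof
    fix V assume "V \<in> \<V>"
    then have V: "V \<subseteq> msgs" "V \<noteq> {}" "card V \<le> B" using assms by auto
    then have "finite V" using finite_msgs finite_subset by blast
    then obtain xs where xs: "set xs = V" "distinct xs" using finite_distinct_list by blast
    then have "length xs \<le> B" "xs \<noteq> []" using V distinct_card by fastforce+
    then have "length (xs @ replicate (B - length xs) (hd xs)) = B"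
      "set (xs @ replicate (B - length xs) (hd xs)) = V" using xs by (auto simp: hd_in_set)
    then show "V \<in> set ` ?L" using V(1) by blast
  qed
  then have "(\<Sum>V\<in>\<V>. orth_prob V ^ K) \<le> (\<Sum>V\<in>set ` ?L. orth_prob V ^ K)"
    using finL by (intro sum_mono2) auto
  also have "\<dots> \<le> (\<Sum>xs\<in>?L. orth_prob (set xs) ^ K)"
    using finL sum_image_le[of ?L "\<lambda>V. orth_prob V ^ K" set] by (simp add: comp_def)
  also have "\<dots> \<le> (real ((q ^ n) ^ B) + 1) ^ B" by (rule sum_orth_prob_lists_le) simp
  finally show ?thesis .
qed

end

section \<open>Union bounds over all blocks\<close>

context coord_field
begin

text \<open>The random choices sorted by position of the outer code: an outer column together with
  an inner matrix. Events about different blocks are therefore independent.\<close>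

definition blocks :: "nat \<Rightarrow> (nat \<Rightarrow> (nat \<Rightarrow> nat \<Rightarrow> 'a) \<times> (nat \<Rightarrow> nat \<Rightarrow> 'a)) set" where
  "blocks N = {..<N} \<rightarrow>\<^sub>E (msgs \<times> mats)"

text \<open>The kernel of the encoding followed by projection to selected positions. In use,
  \<open>S j\<close> holds the unerased positions of block \<open>j\<close>, or all of them when the
  rate is computed.\<close>

definition zero_msgs where
  "zero_msgs N S \<omega> = {m\<in>msgs. \<forall>j<N. vanish {m} (S j) (\<omega> j)}"

lemma finite_blocks: "finite (blocks N)"
  by (simp add: blocks_def finite_PiE finite_msgs finite_mats)

lemma blocks_nonempty: "blocks N \<noteq> {}"
  using msgs_zero mats_nonempty by (auto simp: blocks_def PiE_eq_empty_iff)

lemma blocks_nth: "\<omega> \<in> blocks N \<Longrightarrow> j < N \<Longrightarrow> \<omega> j \<in> msgs \<times> mats"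
  unfolding blocks_def by (metis PiE_mem lessThan_iff)

lemma subsp_zero_msgs:
  assumes "\<omega> \<in> blocks N"
  shows "subsp (zero_msgs N S \<omega>)"
proof -
  have a: "fst (\<omega> j) \<in> msgs" if "j < N" for j
    using blocks_nth[OF assms that] by (simp add: mem_Times_iff)
  show ?thesis
    using a by (auto simp: subsp_def diff_closed_def zero_msgs_def vanish_def case_prod_unfold msgs_zero
        msgs_diff msgs_sc ip_zero ip_diff_left ip_sc dot_diff dot_scale) (simp_all add: dot_def)
qed

lemma vanish_zero_msgs: "V \<subseteq> zero_msgs N S \<omega> \<Longrightarrow> j < N \<Longrightarrow> vanish V (S j) (\<omega> j)"
  by (fastforce simp: zero_msgs_def vanish_def case_prod_unfold)

text \<open>Independence multiplies the block bounds, so the exponents \<open>card (S j) / n\<close>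
  add up to at least \<open>\<theta>\<close>.\<close>

lemma blocks_prob_le:
  fixes \<theta> :: real
  assumes V: "subsp V" and S: "\<And>j. j < N \<Longrightarrow> S j \<subseteq> {..<n}" and \<theta>: "\<theta> * n \<le> (\<Sum>j<N. card (S j))"
  shows "unif_prob (blocks N) (\<lambda>\<omega>. \<forall>j<N. vanish V (S j) (\<omega> j)) \<le> (2 ^ card V) ^ N * orth_prob V powr \<theta>"
proof -
  have m: "V \<subseteq> msgs" using V by (simp add: subsp_def)
  have "unif_prob (blocks N) (\<lambda>\<omega>. \<forall>j<N. vanish V (S j) (\<omega> j)) =
      (\<Prod>j<N. unif_prob (msgs \<times> mats) (vanish V (S j)))"
    unfolding blocks_def by (rule unif_prob_PiE)
  also have "\<dots> \<le> (\<Prod>j<N. 2 ^ card V * orth_prob V powr (card (S j) / n))"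
    using V S by (intro prod_mono) (auto simp: unif_prob_nonneg block_prob_le)
  also have "\<dots> = (2 ^ card V) ^ N * orth_prob V powr (\<Sum>j<N. card (S j) / n)"
    using orth_prob_pos[OF m] by (simp add: prod.distrib powr_sum)
  also have "\<dots> \<le> (2 ^ card V) ^ N * orth_prob V powr \<theta>"
  proof (intro mult_left_mono powr_mono')
    show "\<theta> \<le> (\<Sum>j<N. card (S j) / n)"
      using \<theta> n_pos by (simp add: field_simps flip: sum_divide_distrib)
  qed (auto simp: orth_prob_le_1)
  finally show ?thesis .
qed

text \<open>A crude union bound over all position patterns. Its factor \<open>(2 ^ n) ^ N\<close> is
  affordable when the \<open>F\<close>-span of \<open>V\<close> is large.\<close>

lemma blocks_prob_Ex_le:
  fixes \<theta> :: real
  assumes V: "subsp V"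
  shows "unif_prob (blocks N) (\<lambda>\<omega>. \<exists>S. (\<forall>j<N. S j \<subseteq> {..<n}) \<and> \<theta> * n \<le> (\<Sum>j<N. card (S j)) \<and>
      (\<forall>j<N. vanish V (S j) (\<omega> j))) \<le> (2 ^ n) ^ N * ((2 ^ card V) ^ N * orth_prob V powr \<theta>)"
    (is "unif_prob _ ?P \<le> _")
proof -
  define I where "I = {S \<in> {..<N} \<rightarrow>\<^sub>E Pow {..<n}. \<theta> * n \<le> (\<Sum>j<N. card (S j))}"
  have fin: "finite ({..<N} \<rightarrow>\<^sub>E Pow {..<n})" by (simp add: finite_PiE)
  have finI: "finite I" using fin by (simp add: I_def)
  have "card I \<le> card ({..<N} \<rightarrow>\<^sub>E Pow {..<n})" using fin by (intro card_mono) (auto simp: I_def)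
  then have cardI: "card I \<le> (2 ^ n) ^ N" by (simp add: card_funcsetE card_Pow)
  have "unif_prob (blocks N) ?P \<le> unif_prob (blocks N) (\<lambda>\<omega>. \<exists>S\<in>I. \<forall>j<N. vanish V (S j) (\<omega> j))"
  proof (rule unif_prob_mono[OF finite_blocks])
    fix \<omega> assume "?P \<omega>"
    then obtain S where S: "\<forall>j<N. S j \<subseteq> {..<n}" "\<theta> * n \<le> (\<Sum>j<N. card (S j))"
      "\<forall>j<N. vanish V (S j) (\<omega> j)" by blast
    then have "restrict S {..<N} \<in> I" by (auto simp: I_def)
    with S show "\<exists>S\<in>I. \<forall>j<N. vanish V (S j) (\<omega> j)"
      by (intro bexI[of _ "restrict S {..<N}"]) auto
  qed
  also have "\<dots> \<le> (\<Sum>S\<in>I. unif_prob (blocks N) (\<lambda>\<omega>. \<forall>j<N. vanish V (S j) (\<omega> j)))"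
    by (rule unif_prob_Bex[OF finI])
  also have "\<dots> \<le> (\<Sum>S\<in>I. (2 ^ card V) ^ N * orth_prob V powr \<theta>)"
    using V by (intro sum_mono blocks_prob_le) (auto simp: I_def PiE_iff)
  also have "\<dots> = card I * ((2 ^ card V) ^ N * orth_prob V powr \<theta>)" by simp
  also have "\<dots> \<le> real ((2 ^ n) ^ N) * ((2 ^ card V) ^ N * orth_prob V powr \<theta>)"
    using cardI by (intro mult_right_mono of_nat_mono) auto
  finally show ?thesis by simp
qed

text \<open>Here only the set of heavily constrained blocks is union bounded globally; the choice of
  positions inside a block is already absorbed by the block estimate.\<close>
lemma critical_blocks_prob_le:
  fixes l \<theta> :: real
  assumes V: "subsp V" "critical l V" and l: "0 < l"
  shows "unif_prob (blocks N) (\<lambda>\<omega>. \<exists>T\<subseteq>{..<N}. \<theta> \<le> card T \<and>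
      (\<forall>j\<in>T. \<exists>S. S \<subseteq> {..<n} \<and> 2 * n \<le> l * card S \<and> vanish V S (\<omega> j)))
    \<le> 2 ^ N * ((2 ^ (card V + 1)) ^ N * orth_prob V powr \<theta>)"
    (is "unif_prob _ ?P \<le> _")
proof -
  define E where "E = (\<lambda>x. \<exists>S. S \<subseteq> {..<n} \<and> 2 * n \<le> l * card S \<and> vanish V S x)"
  define I where "I = {T. T \<subseteq> {..<N} \<and> \<theta> \<le> card T}"
  have m: "V \<subseteq> msgs" using V by (simp add: subsp_def)
  have IP: "I \<subseteq> Pow {..<N}" by (auto simp: I_def)
  then have finI: "finite I" using finite_subset by blast
  have cardI: "card I \<le> 2 ^ N" using card_mono[OF _ IP] by (simp add: card_Pow)
  have T: "unif_prob (blocks N) (\<lambda>\<omega>. \<forall>j\<in>T. E (\<omega> j)) \<le> (2 ^ (card V + 1)) ^ N * orth_prob V powr \<theta>"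
    if "T \<in> I" for T
  proof -
    have T: "T \<subseteq> {..<N}" "\<theta> \<le> card T" using that by (auto simp: I_def)
    have "unif_prob (blocks N) (\<lambda>\<omega>. \<forall>j\<in>T. E (\<omega> j)) \<le>
        unif_prob (blocks N) (\<lambda>\<omega>. \<forall>j<N. j \<in> T \<longrightarrow> E (\<omega> j))"
      by (rule unif_prob_mono[OF finite_blocks]) auto
    also have "\<dots> = (\<Prod>j<N. unif_prob (msgs \<times> mats) (\<lambda>x. j \<in> T \<longrightarrow> E x))"
      unfolding blocks_def by (rule unif_prob_PiE)
    \<comment> \<open>Blocks outside \<open>T\<close> are bounded trivially by 1; granting them the
      factor \<open>2 ^ (card V + 1)\<close> as well makes the product uniform.\<close>
    also have "\<dots> \<le> (\<Prod>j<N. 2 ^ (card V + 1) * (if j \<in> T then orth_prob V else 1))"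
    proof (rule prod_mono, intro conjI)
      fix j
      show "unif_prob (msgs \<times> mats) (\<lambda>x. j \<in> T \<longrightarrow> E x)
          \<le> 2 ^ (card V + 1) * (if j \<in> T then orth_prob V else 1)"
      proof (cases "j \<in> T")
        case True
        then show ?thesis using critical_block_prob_le[OF V l] by (simp add: E_def)
      next
        case False
        then have "unif_prob (msgs \<times> mats) (\<lambda>x. j \<in> T \<longrightarrow> E x) \<le> 1" by (simp add: unif_prob_def)
        also have "1 \<le> (2::real) ^ (card V + 1)" by (rule one_le_power) simp
        finally show ?thesis using False by simp
      qed
    qed (rule unif_prob_nonneg)
    also have "\<dots> = (2 ^ (card V + 1)) ^ N * orth_prob V ^ card T"
      using T by (simp only: prod.distrib prod_constant card_lessThan prod.If_cases finite_lessThan)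
        (simp add: Int_absorb1)
    also have "orth_prob V ^ card T = orth_prob V powr card T"
      using orth_prob_pos[OF m] by (simp add: powr_realpow)
    also have "(2 ^ (card V + 1)) ^ N * \<dots> \<le> (2 ^ (card V + 1)) ^ N * orth_prob V powr \<theta>"
      using T by (intro mult_left_mono powr_mono') (auto simp: orth_prob_le_1)
    finally show ?thesis .
  qed
  have "unif_prob (blocks N) ?P \<le> unif_prob (blocks N) (\<lambda>\<omega>. \<exists>T\<in>I. \<forall>j\<in>T. E (\<omega> j))"
    by (rule unif_prob_mono[OF finite_blocks]) (auto simp: I_def E_def)
  also have "\<dots> \<le> (\<Sum>T\<in>I. unif_prob (blocks N) (\<lambda>\<omega>. \<forall>j\<in>T. E (\<omega> j)))"
    by (rule unif_prob_Bex[OF finI])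
  also have "\<dots> \<le> (\<Sum>T\<in>I. (2 ^ (card V + 1)) ^ N * orth_prob V powr \<theta>)"
    by (intro sum_mono T)
  also have "\<dots> = card I * ((2 ^ (card V + 1)) ^ N * orth_prob V powr \<theta>)" by simp
  also have "\<dots> \<le> real (2 ^ N) * ((2 ^ (card V + 1)) ^ N * orth_prob V powr \<theta>)"
    using cardI by (intro mult_right_mono of_nat_mono) auto
  finally show ?thesis by simp
qed

text \<open>Take a subspace of maximal weight. The zero space has weight at most 1, while
  \<open>V\<close> has weight above \<open>q powr (D - l * d)\<close>, hence above 1, so the
  maximiser is nonzero.\<close>

lemma exists_critical:
  assumes V: "subsp V" and l: "0 < l" and big: "(1 / q ^ n) ^ d < orth_prob V" "l * d \<le> D" "q ^ D \<le> card V"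
  shows "\<exists>W. subsp W \<and> W \<subseteq> V \<and> W \<noteq> {0} \<and> critical l W"
proof -
  define f where "f = (\<lambda>W. card W * orth_prob W powr (l / n))"
  define X where "X = {W. subsp W \<and> W \<subseteq> V}"
  have "finite X" using subsp_finite[OF V] by (auto simp: X_def intro: finite_subset[of _ "Pow V"])
  moreover have "V \<in> X" using V by (simp add: X_def)
  ultimately have "Max (f ` X) \<in> f ` X" and max: "\<And>W. W \<in> X \<Longrightarrow> f W \<le> Max (f ` X)"
    by (auto intro!: Max_in)
  then obtain W where W: "W \<in> X" "f W = Max (f ` X)" by auto
  have "critical l W" unfolding critical_def f_def[symmetric]
    using W max by (auto simp: X_def f_def)
  moreover have "W \<noteq> {0}"
  proof
    assume "W = {0}"
    then have "f W \<le> 1"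
      using orth_prob_le_1[of "{0}"] l by (auto simp: f_def intro!: powr_le1)
    moreover have "1 < f V"
    proof -
      have q: "0 < real q" using q_ge_2 by simp
      have "((1 / q ^ n) ^ d) powr (l / n) = q powr (- l * d)"
      proof -
        have "(1 / real (q ^ n)) ^ d = q powr (- real n * d)"
          using q by (simp add: powr_minus powr_realpow[symmetric] powr_powr divide_simps)
        then show ?thesis using n_pos by (simp add: powr_powr mult.commute)
      qed
      moreover have "((1 / q ^ n) ^ d) powr (l / n) < orth_prob V powr (l / n)"
        using big l n_pos by (intro powr_less_mono2) auto
      ultimately have less: "q powr (- l * d) < orth_prob V powr (l / n)" by simp
      have "1 = q powr (l * d) * q powr (- l * d)" using q by (simp flip: powr_add)
      also have "\<dots> \<le> q powr D * q powr (- l * d)"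
        using big(2) q_ge_2 by (intro mult_right_mono powr_mono) auto
      also have "\<dots> = real (q ^ D) * q powr (- l * d)" using q by (simp add: powr_realpow)
      also have "\<dots> \<le> card V * q powr (- l * d)"
        using big(3) by (intro mult_right_mono of_nat_mono) auto
      also have "\<dots> < f V" unfolding f_def
        using less subsp_card_pos[OF V] by (intro mult_strict_left_mono) auto
      finally show ?thesis .
    qed
    ultimately show False using max[of V] V W by (simp add: X_def)
  qed
  ultimately show ?thesis using W by (auto simp: X_def)
qed

text \<open>Choose a space of exactly \<open>q ^ D\<close> zero messages and distinguish whether its
  \<open>F\<close>-span has at least \<open>(q ^ n) ^ d\<close> elements. If not, a critical
  subspace takes over, with \<open>l = 4 / \<epsilon>\<close> so that the block condition reads
  \<open>\<epsilon> * n / 2 \<le> card S\<close>.\<close>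

lemma many_zero_msgs_cases:
  fixes \<epsilon> R :: real and N d D :: nat
  assumes \<omega>: "\<omega> \<in> blocks N" and \<epsilon>: "0 < \<epsilon>" and D: "4 / \<epsilon> * d \<le> D"
    and S: "\<forall>j<N. S j \<subseteq> {..<n}" "(R + \<epsilon>) * N * n \<le> (\<Sum>j<N. card (S j))"
    and big: "q ^ D \<le> card (zero_msgs N S \<omega>)"
  shows "(\<exists>V. subsp V \<and> card V \<le> q ^ D \<and> orth_prob V \<le> (1 / q ^ n) ^ d \<and>
        (\<exists>S. (\<forall>j<N. S j \<subseteq> {..<n}) \<and> (R + \<epsilon>) * N * n \<le> (\<Sum>j<N. card (S j)) \<and>
          (\<forall>j<N. vanish V (S j) (\<omega> j)))) \<or>
    (\<exists>V. subsp V \<and> card V \<le> q ^ D \<and> V \<noteq> {0} \<and> critical (4 / \<epsilon>) V \<and>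
        (\<exists>T\<subseteq>{..<N}. (R + \<epsilon> / 2) * N \<le> card T \<and>
          (\<forall>j\<in>T. \<exists>S. S \<subseteq> {..<n} \<and> 2 * n \<le> 4 / \<epsilon> * card S \<and> vanish V S (\<omega> j))))"
proof -
  obtain V where V: "subsp V" "V \<subseteq> zero_msgs N S \<omega>" "card V = q ^ D"
    using subsp_of_card[OF subsp_zero_msgs[OF \<omega>] big] by blast
  show ?thesis
  proof (cases "orth_prob V \<le> (1 / q ^ n) ^ d")
    case True
    have "\<forall>j<N. vanish V (S j) (\<omega> j)" using vanish_zero_msgs[OF V(2)] by blast
    then show ?thesis using V True S by (intro disjI1 exI[of _ V] conjI exI[of _ S]) auto
  next
    case False
    then obtain W where W: "subsp W" "W \<subseteq> V" "W \<noteq> {0}" "critical (4 / \<epsilon>) W"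
      using exists_critical[of V "4 / \<epsilon>" d D] V \<epsilon> D by auto
    define T where "T = {j. j < N \<and> 2 * n \<le> 4 / \<epsilon> * card (S j)}"
    have T: "T \<subseteq> {..<N}" "finite T" by (auto simp: T_def)
    have card_le: "card (S j) \<le> n" if "j < N" for j using card_mono[of "{..<n}" "S j"] S that by auto
    have "(R + \<epsilon>) * N * n \<le> (\<Sum>j<N. real (card (S j)))" using S by simp
    \<comment> \<open>Averaging: a block outside \<open>T\<close> has fewer than
      \<open>\<epsilon> * n / 2\<close> unerased positions, a block in \<open>T\<close> at most
      \<open>n\<close>.\<close>
    also have "\<dots> \<le> (\<Sum>j<N. \<epsilon> * n / 2 + (if j \<in> T then real n else 0))"
      using card_le \<epsilon> by (intro sum_mono) (auto simp: T_def field_simps add_increasing)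
    also have "\<dots> = N * (\<epsilon> * n / 2) + card T * n"
      using T by (simp add: sum.distrib sum.If_cases Int_absorb1)
    finally have "((R + \<epsilon> / 2) * N) * n \<le> card T * real n" by (simp add: algebra_simps)
    then have "(R + \<epsilon> / 2) * N \<le> card T" using n_pos by simp
    moreover have "card W \<le> q ^ D" using card_mono[OF subsp_finite[OF V(1)] W(2)] V(3) by simp
    moreover have "\<forall>j\<in>T. vanish W (S j) (\<omega> j)"
      using vanish_zero_msgs[OF subset_trans[OF W(2) V(2)]] by (simp add: T_def)
    ultimately show ?thesis using W T S(1)
      by (intro disjI2 exI[of _ W] conjI exI[of _ T]) (auto simp: T_def)
  qed
qed

text \<open>In both cases a single \<open>V\<close> has probability at most
  \<open>z * orth_prob V ^ K\<close>. The sum of the \<open>K\<close>-th powers is bounded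
  independently of \<open>N\<close>, so the decay in \<open>z\<close> prevails for large
  \<open>n\<close> and \<open>N\<close>.\<close>

lemma many_zero_msgs_prob_le:
  fixes \<epsilon> R :: real and N d D :: nat
  assumes \<epsilon>: "0 < \<epsilon>" and "0 < N" and K: "real K = R * N" and d: "2 \<le> \<epsilon> * d" and D: "4 / \<epsilon> * d \<le> D"
    and N: "8 * (q ^ D * (q ^ D + 1)) \<le> \<epsilon> * N" and n: "8 * (q ^ D + 3) \<le> \<epsilon> * n"
  shows "unif_prob (blocks N) (\<lambda>\<omega>. \<exists>S. (\<forall>j<N. S j \<subseteq> {..<n}) \<and> (R + \<epsilon>) * N * n \<le> (\<Sum>j<N. card (S j)) \<and>
      q ^ D \<le> card (zero_msgs N S \<omega>)) \<le> q powr (- (\<epsilon> / 4) * n * N)"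
    (is "unif_prob _ ?P \<le> _")
proof -
  define B where "B = q ^ D"
  define \<A> where "\<A> = {V. subsp V \<and> card V \<le> B \<and> orth_prob V \<le> (1 / q ^ n) ^ d}"
  define \<B> where "\<B> = {V. subsp V \<and> card V \<le> B \<and> V \<noteq> {0} \<and> critical (4 / \<epsilon>) V}"
  define PA where "PA = (\<lambda>V \<omega>. \<exists>S. (\<forall>j<N. S j \<subseteq> {..<n}) \<and> (R + \<epsilon>) * N * n \<le> (\<Sum>j<N. card (S j)) \<and>
          (\<forall>j<N. vanish V (S j) (\<omega> j)))"
  define PB where "PB = (\<lambda>V \<omega>. \<exists>T\<subseteq>{..<N}. (R + \<epsilon> / 2) * N \<le> card T \<and>
          (\<forall>j\<in>T. \<exists>S. S \<subseteq> {..<n} \<and> 2 * n \<le> 4 / \<epsilon> * card S \<and> vanish V S (\<omega> j)))"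
  define z where "z = 2 ^ ((B + 2) * N) * q powr (- (\<epsilon> / 2) * n * N)"
  have q: "2 \<le> real q" using q_ge_2 by simp
  have Qinv: "1 / real (q ^ n) = q powr (- real n)"
    using q by (simp add: powr_minus powr_realpow divide_simps)
  have z: "0 \<le> z" by (simp add: z_def)
  have AB: "\<A> \<subseteq> Pow msgs" "\<B> \<subseteq> Pow msgs" by (auto simp: \<A>_def \<B>_def subsp_def)
  then have finAB: "finite \<A>" "finite \<B>" using finite_msgs finite_subset by blast+
  have half: "orth_prob V powr (\<epsilon> / 2 * N) \<le> q powr (- (\<epsilon> / 2) * n * N)"
    if "orth_prob V \<le> 1 / real (q ^ n)" for V
  proof -
    have "orth_prob V powr (\<epsilon> / 2 * N) \<le> (q powr (- real n)) powr (\<epsilon> / 2 * N)"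
      using that \<epsilon> unfolding Qinv by (intro powr_mono2) auto
    then show ?thesis using q by (simp add: powr_powr algebra_simps)
  qed
  have A: "unif_prob (blocks N) (PA V) \<le> z * orth_prob V ^ K" if "V \<in> \<A>" for V
  proof -
    have V: "subsp V" "card V \<le> B" "orth_prob V \<le> (1 / q ^ n) ^ d" using that by (auto simp: \<A>_def)
    then have pos: "0 < orth_prob V" by (auto simp: subsp_def orth_prob_pos)
    have "d \<noteq> 0" using d by (intro notI) simp
    then have "(1 / real (q ^ n)) ^ d \<le> (1 / real (q ^ n)) ^ 1"
      using one_le_power[of "real q" n] q by (intro power_decreasing) auto
    then have small: "orth_prob V \<le> 1 / real (q ^ n)" using V by simp
    \<comment> \<open>Because \<open>2 \<le> \<epsilon> * d\<close>, half of the surplus exponent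
      already cancels the \<open>(2 ^ n) ^ N\<close> position patterns.\<close>
    have "orth_prob V powr (\<epsilon> / 2 * N) \<le> ((1 / q ^ n) ^ d) powr (\<epsilon> / 2 * N)"
      using V \<epsilon> by (intro powr_mono2) auto
    also have "\<dots> = q powr (- (n * N * (\<epsilon> * d / 2)))"
      unfolding Qinv using q by (simp add: powr_powr algebra_simps flip: powr_realpow)
    also have "\<dots> \<le> q powr (- (real n * N))"
      using d q mult_left_mono[of 1 "\<epsilon> * d / 2" "real n * N"] by (intro powr_mono) auto
    finally have "orth_prob V powr (\<epsilon> / 2 * N) \<le> q powr (- (real n * N))" .
    then have "(2 ^ n) ^ N * orth_prob V powr (\<epsilon> / 2 * N) \<le> (real q ^ n) ^ N * q powr (- (real n * N))"
      using q by (intro mult_mono power_mono) auto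
    also have "\<dots> = 1" using q by (simp add: powr_minus powr_realpow flip: power_mult of_nat_mult)
    finally have one: "(2 ^ n) ^ N * orth_prob V powr (\<epsilon> / 2 * N) \<le> 1" .
    have "(2 ^ card V) ^ N \<le> (2::real) ^ ((B + 2) * N)"
      unfolding power_mult[symmetric] using V(2) by (intro power_increasing mult_right_mono) auto
    then have BN: "(2 ^ card V) ^ N * orth_prob V powr (\<epsilon> / 2 * N) \<le> z"
      unfolding z_def using half[OF small] by (intro mult_mono) auto
    have "unif_prob (blocks N) (PA V) \<le> (2 ^ n) ^ N * ((2 ^ card V) ^ N * orth_prob V powr ((R + \<epsilon>) * N))"
      unfolding PA_def by (rule blocks_prob_Ex_le[OF V(1)])
    \<comment> \<open>The exponent splits as \<open>K\<close> for the count of spaces, one half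
      surplus for the patterns and one half for the final decay.\<close>
    also have "orth_prob V powr ((R + \<epsilon>) * N) =
        orth_prob V ^ K * orth_prob V powr (\<epsilon> / 2 * N) * orth_prob V powr (\<epsilon> / 2 * N)"
      using pos by (simp add: K algebra_simps flip: powr_realpow powr_add)
    also have "(2 ^ n) ^ N * ((2 ^ card V) ^ N * \<dots>) = ((2 ^ n) ^ N * orth_prob V powr (\<epsilon> / 2 * N)) *
        ((2 ^ card V) ^ N * orth_prob V powr (\<epsilon> / 2 * N)) * orth_prob V ^ K" by simp
    also have "\<dots> \<le> 1 * z * orth_prob V ^ K"
      using one BN z by (intro mult_right_mono mult_mono) auto
    finally show ?thesis by simp
  qed
  have B: "unif_prob (blocks N) (PB V) \<le> z * orth_prob V ^ K" if "V \<in> \<B>" for V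
  proof -
    have V: "subsp V" "card V \<le> B" "V \<noteq> {0}" "critical (4 / \<epsilon>) V" using that by (auto simp: \<B>_def)
    then have m: "V \<subseteq> msgs" by (simp add: subsp_def)
    have pos: "0 < orth_prob V" by (rule orth_prob_pos[OF m])
    obtain v where "v \<in> V" "v \<noteq> 0" using V(3) subsp_zero[OF V(1)] by blast
    then have small: "orth_prob V \<le> 1 / real (q ^ n)" using orth_prob_nonzero[OF m] by simp
    \<comment> \<open>The choice of the set of blocks and the additional 2 per block account for the
      \<open>B + 2\<close> in \<open>z\<close>.\<close>
    have "2 ^ N * (2 ^ (card V + 1)) ^ N = (2::real) ^ ((card V + 2) * N)"
      by (simp add: power_mult[symmetric] power_add[symmetric] algebra_simps)
    also have "\<dots> \<le> 2 ^ ((B + 2) * N)" using V(2) by (intro power_increasing mult_right_mono) auto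
    finally have "(2 ^ N * (2 ^ (card V + 1)) ^ N) * orth_prob V powr (\<epsilon> / 2 * N) \<le> z"
      unfolding z_def using half[OF small] by (intro mult_mono) auto
    then have "(2 ^ N * (2 ^ (card V + 1)) ^ N) * orth_prob V powr (\<epsilon> / 2 * N) * orth_prob V ^ K
        \<le> z * orth_prob V ^ K" by (intro mult_right_mono) auto
    moreover have "orth_prob V powr ((R + \<epsilon> / 2) * N) = orth_prob V powr (\<epsilon> / 2 * N) * orth_prob V ^ K"
      using pos by (simp add: K algebra_simps flip: powr_realpow powr_add)
    moreover have "unif_prob (blocks N) (PB V) \<le>
        2 ^ N * ((2 ^ (card V + 1)) ^ N * orth_prob V powr ((R + \<epsilon> / 2) * N))"
      unfolding PB_def using V \<epsilon> by (intro critical_blocks_prob_le) auto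
    ultimately show ?thesis by (simp add: mult.assoc)
  qed
  have sumK: "(\<Sum>V\<in>\<V>. orth_prob V ^ K) \<le> q powr (real n * (B * (B + 1)))"
    if "\<V> = \<A> \<or> \<V> = \<B>" for \<V>
  proof -
    have "(\<Sum>V\<in>\<V>. orth_prob V ^ K) \<le> (real ((q ^ n) ^ B) + 1) ^ B"
      using that by (intro sum_orth_prob_sets_le) (auto simp: \<A>_def \<B>_def subsp_def diff_closed_def)
    also have "\<dots> \<le> (real ((q ^ n) ^ (B + 1))) ^ B"
    proof (rule power_mono)
      \<comment> \<open>The summand 1 is absorbed by one more factor \<open>q ^ n\<close>, which is
        at least 2.\<close>
      have "1 \<le> (q ^ n) ^ B" using q_ge_2 by (intro one_le_power) auto
      moreover have "2 * (q ^ n) ^ B \<le> (q ^ n) ^ (B + 1)"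
        using mult_right_mono[OF q_pow_ge_2, of "(q ^ n) ^ B"] by simp
      ultimately have "(q ^ n) ^ B + 1 \<le> (q ^ n) ^ (B + 1)" by linarith
      then have "real ((q ^ n) ^ B + 1) \<le> real ((q ^ n) ^ (B + 1))" by (rule of_nat_mono)
      then show "real ((q ^ n) ^ B) + 1 \<le> real ((q ^ n) ^ (B + 1))" by simp
    qed auto
    also have "\<dots> = real q ^ (n * (B * (B + 1)))" by (simp add: algebra_simps flip: power_mult power_add)
    also have "\<dots> = q powr real (n * (B * (B + 1)))" using q by (subst powr_realpow) auto
    finally show ?thesis by simp
  qed
  have "unif_prob (blocks N) ?P \<le> unif_prob (blocks N) (\<lambda>\<omega>. (\<exists>V\<in>\<A>. PA V \<omega>) \<or> (\<exists>V\<in>\<B>. PB V \<omega>))"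
  proof (rule unif_prob_mono[OF finite_blocks])
    fix \<omega> assume \<omega>: "\<omega> \<in> blocks N" and "?P \<omega>"
    then obtain S where S: "\<forall>j<N. S j \<subseteq> {..<n}" "(R + \<epsilon>) * N * n \<le> (\<Sum>j<N. card (S j))"
      "q ^ D \<le> card (zero_msgs N S \<omega>)" by blast
    show "(\<exists>V\<in>\<A>. PA V \<omega>) \<or> (\<exists>V\<in>\<B>. PB V \<omega>)"
      using many_zero_msgs_cases[OF \<omega> \<epsilon> D S] unfolding \<A>_def \<B>_def PA_def PB_def B_def by blast
  qed
  also have "\<dots> \<le> unif_prob (blocks N) (\<lambda>\<omega>. \<exists>V\<in>\<A>. PA V \<omega>) + unif_prob (blocks N) (\<lambda>\<omega>. \<exists>V\<in>\<B>. PB V \<omega>)"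
    by (rule unif_prob_disj[OF finite_blocks])
  also have "\<dots> \<le> (\<Sum>V\<in>\<A>. unif_prob (blocks N) (PA V)) + (\<Sum>V\<in>\<B>. unif_prob (blocks N) (PB V))"
    using finAB by (intro add_mono unif_prob_Bex)
  also have "\<dots> \<le> (\<Sum>V\<in>\<A>. z * orth_prob V ^ K) + (\<Sum>V\<in>\<B>. z * orth_prob V ^ K)"
    using A B by (intro add_mono sum_mono)
  also have "\<dots> = z * ((\<Sum>V\<in>\<A>. orth_prob V ^ K) + (\<Sum>V\<in>\<B>. orth_prob V ^ K))"
    by (simp add: sum_distrib_left distrib_left)
  also have "\<dots> \<le> z * (2 * q powr (real n * (B * (B + 1))))"
    using sumK[of \<A>] sumK[of \<B>] z by (intro mult_left_mono) auto
  also have "\<dots> = 2 ^ ((B + 2) * N + 1) * q powr (- (\<epsilon> / 2) * n * N + real n * (B * (B + 1)))"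
    unfolding z_def powr_add by simp
  also have "\<dots> \<le> q powr ((B + 3) * N) * q powr (- (\<epsilon> / 2) * n * N + real n * (B * (B + 1)))"
  proof (rule mult_right_mono)
    \<comment> \<open>The additional factor 2 stems from the two families of spaces;
      \<open>0 < N\<close> lets it be absorbed.\<close>
    have "(2::real) ^ ((B + 2) * N + 1) \<le> 2 ^ ((B + 3) * N)"
      using \<open>0 < N\<close> by (intro power_increasing) (auto simp: algebra_simps)
    also have "\<dots> \<le> real q ^ ((B + 3) * N)" using q by (intro power_mono) auto
    also have "\<dots> = q powr ((B + 3) * N)" using q by (simp add: powr_realpow flip: of_nat_mult)
    finally show "(2::real) ^ ((B + 2) * N + 1) \<le> q powr ((B + 3) * N)" .
  qed auto
  also have "\<dots> = q powr ((B + 3) * N + (- (\<epsilon> / 2) * n * N + real n * (B * (B + 1))))"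
    by (simp add: powr_add)
  also have "\<dots> \<le> q powr (- (\<epsilon> / 4) * n * N)"
  proof (rule powr_mono)
    \<comment> \<open>Each of the two error exponents is at most
      \<open>\<epsilon> * n * N / 8\<close>, so \<open>\<epsilon> / 4\<close> of the initial
      \<open>\<epsilon> / 2\<close> survives.\<close>
    have "8 * (real B + 3) \<le> \<epsilon> * n" using n by (simp add: B_def)
    then have "8 * (real B + 3) * N \<le> \<epsilon> * n * N" by (intro mult_right_mono) auto
    moreover have "8 * (real B * (B + 1)) \<le> \<epsilon> * N" using N by (simp add: B_def algebra_simps)
    then have "real n * (8 * (real B * (B + 1))) \<le> n * (\<epsilon> * N)" by (intro mult_left_mono) auto
    ultimately show "(B + 3) * N + (- (\<epsilon> / 2) * n * N + real n * (B * (B + 1))) \<le> - (\<epsilon> / 4) * n * N"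
      by (simp add: algebra_simps)
  qed (use q in auto)
  finally show ?thesis .
qed

text \<open>Union bound over nonzero messages \<open>m\<close>. Each is replaced by its F_q-line,
  which has \<open>q\<close> elements, and all positions are constrained, so the exponent is
  \<open>N\<close>.\<close>

lemma not_injective_prob_le:
  "unif_prob (blocks N) (\<lambda>\<omega>. zero_msgs N (\<lambda>_. {..<n}) \<omega> \<noteq> {0})
    \<le> card msgs * ((2 ^ q) ^ N * (1 / q ^ n) ^ N)"
proof -
  have one: "unif_prob (blocks N) (\<lambda>\<omega>. m \<in> zero_msgs N (\<lambda>_. {..<n}) \<omega>) \<le> (2 ^ q) ^ N * (1 / q ^ n) ^ N"
    if m: "m \<in> msgs - {0}" for m
  proof -
    have "subsp {0}" by (auto simp: subsp_def diff_closed_def msgs_zero)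
    then obtain V where V: "subsp V" "m \<in> V" "card V = q * card {0 :: nat \<Rightarrow> nat \<Rightarrow> 'a}"
        and least: "\<And>W. subsp W \<Longrightarrow> {0} \<subseteq> W \<Longrightarrow> m \<in> W \<Longrightarrow> V \<subseteq> W"
      using subsp_extend[of "{0}" m] m by (metis DiffD1 DiffD2)
    have Vm: "V \<subseteq> msgs" using V by (simp add: subsp_def)
    have "unif_prob (blocks N) (\<lambda>\<omega>. m \<in> zero_msgs N (\<lambda>_. {..<n}) \<omega>) \<le>
        unif_prob (blocks N) (\<lambda>\<omega>. \<forall>j<N. vanish V {..<n} (\<omega> j))"
    proof (rule unif_prob_mono[OF finite_blocks])
      fix \<omega> assume "\<omega> \<in> blocks N" "m \<in> zero_msgs N (\<lambda>_. {..<n}) \<omega>"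
      then have "V \<subseteq> zero_msgs N (\<lambda>_. {..<n}) \<omega>" using least subsp_zero_msgs subsp_zero by blast
      then show "\<forall>j<N. vanish V {..<n} (\<omega> j)" using vanish_zero_msgs by blast
    qed
    also have "\<dots> \<le> (2 ^ card V) ^ N * orth_prob V powr real N"
      using V by (intro blocks_prob_le) auto
    also have "\<dots> = (2 ^ q) ^ N * orth_prob V ^ N"
      using orth_prob_pos[OF Vm] by (simp add: powr_realpow V(3))
    also have "\<dots> \<le> (2 ^ q) ^ N * (1 / q ^ n) ^ N"
      using orth_prob_nonzero[OF Vm V(2)] m by (intro mult_left_mono power_mono) auto
    finally show ?thesis .
  qed
  have "unif_prob (blocks N) (\<lambda>\<omega>. zero_msgs N (\<lambda>_. {..<n}) \<omega> \<noteq> {0}) \<le>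
      unif_prob (blocks N) (\<lambda>\<omega>. \<exists>m\<in>msgs - {0}. m \<in> zero_msgs N (\<lambda>_. {..<n}) \<omega>)"
  proof (rule unif_prob_mono[OF finite_blocks])
    fix \<omega> assume "\<omega> \<in> blocks N" and ne: "zero_msgs N (\<lambda>_. {..<n}) \<omega> \<noteq> {0}"
    then have "0 \<in> zero_msgs N (\<lambda>_. {..<n}) \<omega>" using subsp_zero_msgs subsp_zero by blast
    with ne show "\<exists>m\<in>msgs - {0}. m \<in> zero_msgs N (\<lambda>_. {..<n}) \<omega>" by (auto simp: zero_msgs_def)
  qed
  also have "\<dots> \<le> (\<Sum>m\<in>msgs - {0}. unif_prob (blocks N) (\<lambda>\<omega>. m \<in> zero_msgs N (\<lambda>_. {..<n}) \<omega>))"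
    by (rule unif_prob_Bex) (simp add: finite_msgs)
  also have "\<dots> \<le> (\<Sum>m\<in>msgs - {0}. (2 ^ q) ^ N * (1 / q ^ n) ^ N)" by (intro sum_mono one)
  also have "\<dots> \<le> (\<Sum>m\<in>msgs. (2 ^ q) ^ N * (1 / q ^ n) ^ N)"
    by (intro sum_mono2) (auto simp: finite_msgs)
  finally show ?thesis by simp
qed

end

section \<open>Concatenated codes\<close>

lemma coord_field_ext_field:
  fixes F :: "(nat \<Rightarrow> 'a::{finite,field}) ring"
  assumes "ext_field_coords n F"
  shows "coord_field n CARD('a) (mult F)" and "zero F = 0"
proof -
  have F: "field F" and car: "carrier F = vecs n"
    and add: "\<And>u v. u \<in> vecs n \<Longrightarrow> v \<in> vecs n \<Longrightarrow> u \<oplus>\<^bsub>F\<^esub> v = u + v"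
    and scale: "\<And>c v. v \<in> vecs n \<Longrightarrow> (\<lambda>i. c * (\<one>\<^bsub>F\<^esub>) i) \<otimes>\<^bsub>F\<^esub> v = (\<lambda>i. c * v i)"
    using assms by (auto simp: ext_field_coords_def plus_fun_def)
  interpret F: field F by (rule F)
  have closed: "\<And>u v. u \<in> vecs n \<Longrightarrow> v \<in> vecs n \<Longrightarrow> u \<otimes>\<^bsub>F\<^esub> v \<in> vecs n"
    and one: "\<one>\<^bsub>F\<^esub> \<in> vecs n" and zero: "\<zero>\<^bsub>F\<^esub> \<in> vecs n"
    using F.m_closed F.one_closed F.zero_closed by (auto simp: car)
  have "\<zero>\<^bsub>F\<^esub> + \<zero>\<^bsub>F\<^esub> = \<zero>\<^bsub>F\<^esub>" using F.add.r_one[of "\<zero>\<^bsub>F\<^esub>"] zero by (simp add: add car)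
  then show z: "\<zero>\<^bsub>F\<^esub> = 0" by (metis add_cancel_right_right)
  show "coord_field n CARD('a) (mult F)"
  proof
    \<comment> \<open>For \<open>n = 0\<close> the carrier would be a single point, contradicting
      that one differs from zero in a field.\<close>
    show "0 < n"
    proof (rule ccontr)
      assume "\<not> 0 < n"
      then have "vecs n = {0 :: nat \<Rightarrow> 'a}" by (auto simp: vecs_def)
      then show False using one zero F.one_not_zero by auto
    qed
    fix u v w :: "nat \<Rightarrow> 'a" and c :: 'a
    assume u: "u \<in> vecs n"
    show "u \<noteq> 0 \<Longrightarrow> w \<in> vecs n \<Longrightarrow> \<exists>v\<in>vecs n. v \<otimes>\<^bsub>F\<^esub> u = w"
    proof -
      assume "u \<noteq> 0" and w: "w \<in> vecs n"
      then have "u \<in> Units F" using u F.field_Units by (simp add: car z)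
      then have inv: "inv\<^bsub>F\<^esub> u \<in> vecs n" "inv\<^bsub>F\<^esub> u \<otimes>\<^bsub>F\<^esub> u = \<one>\<^bsub>F\<^esub>"
        using F.Units_inv_closed F.Units_l_inv by (auto simp: car)
      then have "(w \<otimes>\<^bsub>F\<^esub> inv\<^bsub>F\<^esub> u) \<otimes>\<^bsub>F\<^esub> u = w" using w u by (simp add: F.m_assoc car)
      then show ?thesis using closed[OF w inv(1)] by blast
    qed
    assume v: "v \<in> vecs n"
    show "u \<otimes>\<^bsub>F\<^esub> v \<in> vecs n" using u v by (rule closed)
    show "u \<otimes>\<^bsub>F\<^esub> v = v \<otimes>\<^bsub>F\<^esub> u" using u v by (simp add: F.m_comm car)
    have c1: "(\<lambda>i. c * (\<one>\<^bsub>F\<^esub>) i) \<in> vecs n" using one by (rule vecs_closed)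
    \<comment> \<open>Scaling by \<open>c\<close> is multiplication by the field element
      \<open>c\<close> times one, so associativity moves it outside the product.\<close>
    have "(\<lambda>i. c * u i) \<otimes>\<^bsub>F\<^esub> v = ((\<lambda>i. c * (\<one>\<^bsub>F\<^esub>) i) \<otimes>\<^bsub>F\<^esub> u) \<otimes>\<^bsub>F\<^esub> v" using u by (simp add: scale)
    also have "\<dots> = (\<lambda>i. c * (\<one>\<^bsub>F\<^esub>) i) \<otimes>\<^bsub>F\<^esub> (u \<otimes>\<^bsub>F\<^esub> v)" using c1 u v by (simp add: F.m_assoc car)
    also have "\<dots> = (\<lambda>i. c * (u \<otimes>\<^bsub>F\<^esub> v) i)" using closed[OF u v] by (rule scale)
    finally show "(\<lambda>l. c * u l) \<otimes>\<^bsub>F\<^esub> v = (\<lambda>l. c * (u \<otimes>\<^bsub>F\<^esub> v) l)" .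
    assume w: "w \<in> vecs n"
    show "u \<otimes>\<^bsub>F\<^esub> v \<otimes>\<^bsub>F\<^esub> w = u \<otimes>\<^bsub>F\<^esub> (v \<otimes>\<^bsub>F\<^esub> w)" using u v w by (simp add: F.m_assoc car)
    show "(u + v) \<otimes>\<^bsub>F\<^esub> w = u \<otimes>\<^bsub>F\<^esub> w + v \<otimes>\<^bsub>F\<^esub> w"
      using F.l_distr[of u v w] u v w closed by (simp add: car add)
  qed simp
qed

lemma finsum_ext_field:
  fixes F :: "(nat \<Rightarrow> 'a::{finite,field}) ring"
  assumes F: "ext_field_coords n F" and "finite A" and "\<And>i. i \<in> A \<Longrightarrow> f i \<in> vecs n"
  shows "finsum F f A = sum f A"
  using assms(2,3)
proof (induction A rule: finite_induct)
  case empty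
  interpret F: field F using F by (simp add: ext_field_coords_def)
  show ?case using coord_field_ext_field(2)[OF F] by simp
next
  case (insert x A)
  interpret F: field F using F by (simp add: ext_field_coords_def)
  have car: "carrier F = vecs n" and add: "\<And>u v. u \<in> vecs n \<Longrightarrow> v \<in> vecs n \<Longrightarrow> u \<oplus>\<^bsub>F\<^esub> v = u + v"
    using F by (auto simp: ext_field_coords_def plus_fun_def)
  have "finsum F f (insert x A) = f x \<oplus>\<^bsub>F\<^esub> finsum F f A"
    using insert by (intro F.finsum_insert) (auto simp: car)
  also have "\<dots> = f x + sum f A" using insert sum_vecs[of A f n] by (simp add: add)
  finally show ?case using insert by simp
qed

text \<open>Regroups the matrices by blocks. Outer columns are extended by zero, and the inner
  indices are swapped so that the second component lists columns.\<close>

definition block_view :: "nat \<Rightarrow> nat \<Rightarrow> nat \<Rightarrow> (nat \<Rightarrow> nat \<Rightarrow> nat \<Rightarrow> 'a::zero) \<times> (nat \<Rightarrow> nat \<Rightarrow> nat \<Rightarrow> 'a) \<Rightarrow>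
    nat \<Rightarrow> (nat \<Rightarrow> nat \<Rightarrow> 'a) \<times> (nat \<Rightarrow> nat \<Rightarrow> 'a)" where
  "block_view n N K = (\<lambda>(A, G). \<lambda>j\<in>{..<N}. (\<lambda>i. if i < K then A i j else 0,
     \<lambda>k\<in>{..<n}. \<lambda>l. if l < n then G j l k else 0))"

context coord_field
begin

text \<open>A bijection transports the uniform distribution on the generator matrices to the uniform
  distribution on blocks.\<close>

lemma bij_block_view:
  assumes car: "carrier F = vecs n"
  shows "bij_betw (block_view n N K) (outer_mats F K N \<times> inner_mats n N) (blocks N)"
proof (rule bij_betw_byWitness[where f' = "\<lambda>\<omega>. (\<lambda>i\<in>{..<K}. \<lambda>j\<in>{..<N}. fst (\<omega> j) i,
    \<lambda>j\<in>{..<N}. \<lambda>l\<in>{..<n}. \<lambda>k\<in>{..<n}. snd (\<omega> j) k l)"])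
  show "\<forall>x\<in>outer_mats F K N \<times> inner_mats n N.
       (\<lambda>i\<in>{..<K}. \<lambda>j\<in>{..<N}. fst (block_view n N K x j) i,
        \<lambda>j\<in>{..<N}. \<lambda>l\<in>{..<n}. \<lambda>k\<in>{..<n}. snd (block_view n N K x j) k l) = x"
  proof
    fix x :: "(nat \<Rightarrow> nat \<Rightarrow> nat \<Rightarrow> 'a) \<times> (nat \<Rightarrow> nat \<Rightarrow> nat \<Rightarrow> 'a)"
    assume "x \<in> outer_mats F K N \<times> inner_mats n N"
    then obtain A G where x: "x = (A, G)" and AG: "A \<in> outer_mats F K N" "G \<in> inner_mats n N"
      by blast
    have "(\<lambda>i\<in>{..<K}. \<lambda>j\<in>{..<N}. fst (block_view n N K (A, G) j) i) = A"
      using AG(1) unfolding block_view_def outer_mats_def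
      by (auto simp: fun_eq_iff PiE_def extensional_def Pi_def)
    moreover have "(\<lambda>j\<in>{..<N}. \<lambda>l\<in>{..<n}. \<lambda>k\<in>{..<n}. snd (block_view n N K (A, G) j) k l) = G"
      using AG(2) unfolding block_view_def inner_mats_def
      by (auto simp: fun_eq_iff PiE_def extensional_def Pi_def)
    ultimately show "(\<lambda>i\<in>{..<K}. \<lambda>j\<in>{..<N}. fst (block_view n N K x j) i,
        \<lambda>j\<in>{..<N}. \<lambda>l\<in>{..<n}. \<lambda>k\<in>{..<n}. snd (block_view n N K x j) k l) = x" by (simp only: x)
  qed
  show "\<forall>\<omega>\<in>blocks N. block_view n N K (\<lambda>i\<in>{..<K}. \<lambda>j\<in>{..<N}. fst (\<omega> j) i,
      \<lambda>j\<in>{..<N}. \<lambda>l\<in>{..<n}. \<lambda>k\<in>{..<n}. snd (\<omega> j) k l) = \<omega>"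
  proof (intro ballI ext)
    fix \<omega> j assume \<omega>: "\<omega> \<in> blocks N"
    show "block_view n N K (\<lambda>i\<in>{..<K}. \<lambda>j\<in>{..<N}. fst (\<omega> j) i,
      \<lambda>j\<in>{..<N}. \<lambda>l\<in>{..<n}. \<lambda>k\<in>{..<n}. snd (\<omega> j) k l) j = \<omega> j"
    proof (cases "j < N")
      case True
      then have "\<omega> j \<in> msgs \<times> mats" using \<omega> by (intro blocks_nth)
      then obtain a H where aH: "\<omega> j = (a, H)" "a \<in> msgs" "H \<in> mats" by auto
      have "(\<lambda>i. if i < K then a i else 0) = a" using aH(2) by (auto simp: msgs_def fun_eq_iff)
      moreover have "(\<lambda>k\<in>{..<n}. \<lambda>l. if l < n then H k l else 0) = H"
        using aH(3) by (auto simp: mats_def fun_eq_iff PiE_def extensional_def Pi_def vecs_def)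
      ultimately show ?thesis using True aH(1)
        by (auto simp: block_view_def fun_eq_iff cong: if_cong)
    next
      case False
      then show ?thesis using \<omega> by (auto simp: blocks_def block_view_def PiE_def extensional_def)
    qed
  qed
  show "block_view n N K ` (outer_mats F K N \<times> inner_mats n N) \<subseteq> blocks N"
    unfolding block_view_def outer_mats_def inner_mats_def blocks_def mats_def msgs_def
    by (auto simp: PiE_iff vecs_def car)
  show "(\<lambda>\<omega>. (\<lambda>i\<in>{..<K}. \<lambda>j\<in>{..<N}. fst (\<omega> j) i,
        \<lambda>j\<in>{..<N}. \<lambda>l\<in>{..<n}. \<lambda>k\<in>{..<n}. snd (\<omega> j) k l)) ` blocks N
      \<subseteq> outer_mats F K N \<times> inner_mats n N"
    using msgs_nth unfolding blocks_def outer_mats_def inner_mats_def car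
    by (auto simp: PiE_iff mem_Times_iff)
qed

section \<open>Decoding lists and rate of the encoding map\<close>

definition enc where
  "enc N \<omega> m = map (\<lambda>t. dot n (ip m (fst (\<omega> (t div n)))) (snd (\<omega> (t div n)) (t mod n))) [0..<n * N]"

lemma length_enc [simp]: "length (enc N \<omega> m) = n * N"
  by (simp add: enc_def)

lemma div_less_blocks: "t < n * N \<Longrightarrow> t div n < N"
  by (rule less_mult_imp_div_less) (simp only: mult.commute)

lemma enc_nth_eq_iff:
  assumes "\<omega> \<in> blocks N" "m \<in> msgs" "m' \<in> msgs" "t < n * N"
  shows "enc N \<omega> m ! t = enc N \<omega> m' ! t \<longleftrightarrow> vanish {m - m'} {t mod n} (\<omega> (t div n))"
proof -
  have "\<omega> (t div n) \<in> msgs \<times> mats"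
    by (rule blocks_nth[OF assms(1) div_less_blocks[OF assms(4)]])
  then have "fst (\<omega> (t div n)) \<in> msgs" by (simp add: mem_Times_iff)
  then show ?thesis using assms
    by (simp add: enc_def vanish_def case_prod_unfold ip_diff_left dot_diff)
qed

text \<open>Two codewords that agree with \<open>y\<close> coincide on the unerased positions.
  Subtracting one fixed agreeing message therefore sends all of them into the kernel.\<close>

lemma card_agrees_le:
  assumes \<omega>: "\<omega> \<in> blocks N" and y: "length y = n * N"
  defines "S \<equiv> \<lambda>j. {k. k < n \<and> y ! (j * n + k) \<noteq> None}"
  shows "card {c \<in> enc N \<omega> ` msgs. agrees c y} \<le> card (zero_msgs N S \<omega>)"
proof (cases "\<exists>m0\<in>msgs. agrees (enc N \<omega> m0) y")
  case True
  then obtain m0 where m0: "m0 \<in> msgs" "agrees (enc N \<omega> m0) y" by blast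
  have fin: "finite (zero_msgs N S \<omega>)" by (rule subsp_finite[OF subsp_zero_msgs[OF \<omega>]])
  have "{c \<in> enc N \<omega> ` msgs. agrees c y} \<subseteq> (\<lambda>m. enc N \<omega> (m + m0)) ` zero_msgs N S \<omega>"
  proof clarify
    fix m assume m: "m \<in> msgs" "agrees (enc N \<omega> m) y"
    have "vanish {m - m0} (S j) (\<omega> j)" if j: "j < N" for j
    proof -
      have "vanish {m - m0} {k} (\<omega> j)" if "k \<in> S j" for k
      proof -
        let ?t = "j * n + k"
        have k: "k < n" "y ! ?t \<noteq> None" using that by (auto simp: S_def)
        have "?t < (j + 1) * n" using k by simp
        also have "\<dots> \<le> N * n" using j by (intro mult_right_mono) auto
        finally have t: "?t < n * N" by (simp add: mult.commute)
        have "enc N \<omega> m ! ?t = enc N \<omega> m0 ! ?t"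
          using m(2) m0(2) k(2) t y unfolding agrees_def by (metis option.inject)
        then show ?thesis using enc_nth_eq_iff[OF \<omega> m(1) m0(1) t] k by simp
      qed
      then show ?thesis by (auto simp: vanish_def case_prod_unfold)
    qed
    then have "m - m0 \<in> zero_msgs N S \<omega>" using m m0 by (simp add: zero_msgs_def msgs_diff)
    then show "enc N \<omega> m \<in> (\<lambda>m. enc N \<omega> (m + m0)) ` zero_msgs N S \<omega>"
      by (intro image_eqI[of _ _ "m - m0"]) auto
  qed
  then show ?thesis using surj_card_le[OF fin] by blast
next
  case False
  then have "{c \<in> enc N \<omega> ` msgs. agrees c y} = {}" by auto
  then show ?thesis by (simp only: card.empty le0)
qed

lemma sum_card_unerased:
  assumes y: "length y = n * N"
  shows "(\<Sum>j<N. card {k. k < n \<and> y ! (j * n + k) \<noteq> None}) + erasure_wt y = n * N"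
proof -
  have "card {k. k < n \<and> y ! (j * n + k) \<noteq> None} =
      (\<Sum>t\<in>{j * n..<j * n + n}. if y ! t \<noteq> None then 1 else 0)" for j
  proof -
    have "(\<Sum>t\<in>{j * n..<j * n + n}. if y ! t \<noteq> None then 1 else (0::nat)) =
        (\<Sum>k\<in>{0..<n}. if y ! (k + j * n) \<noteq> None then 1 else 0)"
      using sum.shift_bounds_nat_ivl[of "\<lambda>t. if y ! t \<noteq> None then 1 else (0::nat)" 0 "j * n" n]
      by (simp add: add.commute)
    also have "\<dots> = card {k. k < n \<and> y ! (j * n + k) \<noteq> None}"
      by (simp add: sum.If_cases Int_def add.commute)
    finally show ?thesis by simp
  qed
  then have "(\<Sum>j<N. card {k. k < n \<and> y ! (j * n + k) \<noteq> None}) =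
      (\<Sum>t<N * n. if y ! t \<noteq> None then 1 else 0)"
    using sum.nat_group[of "\<lambda>t. if y ! t \<noteq> None then 1 else (0::nat)" n N] by simp
  moreover have "erasure_wt y = (\<Sum>t<N * n. if y ! t = None then 1 else 0)"
    using y by (simp add: erasure_wt_def sum.If_cases Int_def mult.commute)
  moreover have "(\<Sum>t<N * n. if y ! t \<noteq> None then 1 else (0::nat)) +
      (\<Sum>t<N * n. if y ! t = None then 1 else 0) = (\<Sum>t<N * n. 1)"
    by (subst sum.distrib[symmetric], intro sum.cong) auto
  ultimately show ?thesis by simp
qed

lemma list_decodable_enc:
  fixes \<epsilon> R L :: real
  assumes \<omega>: "\<omega> \<in> blocks N" and L: "q ^ D \<le> L"
    and few: "\<not> (\<exists>S. (\<forall>j<N. S j \<subseteq> {..<n}) \<and> (R + \<epsilon>) * N * n \<le> (\<Sum>j<N. card (S j)) \<and>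
      q ^ D \<le> card (zero_msgs N S \<omega>))"
  shows "led_list_decodable (1 - R - \<epsilon>) L (n * N) (enc N \<omega> ` msgs)"
  unfolding led_list_decodable_def
proof (intro allI impI)
  fix y :: "'a option list"
  assume y: "length y = n * N" and wt: "real (erasure_wt y) \<le> (1 - R - \<epsilon>) * real (n * N)"
  let ?S = "\<lambda>j. {k. k < n \<and> y ! (j * n + k) \<noteq> None}"
  have "real ((\<Sum>j<N. card (?S j)) + erasure_wt y) = real (n * N)"
    using sum_card_unerased[OF y] by (rule arg_cong)
  then have "(R + \<epsilon>) * N * n \<le> (\<Sum>j<N. card (?S j))" using wt by (simp add: algebra_simps)
  then have "card (zero_msgs N ?S \<omega>) < q ^ D" using few by (force simp: not_le[symmetric])
  then have "card {c \<in> enc N \<omega> ` msgs. agrees c y} \<le> q ^ D" using card_agrees_le[OF \<omega> y] by simp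
  then have "real (card {c \<in> enc N \<omega> ` msgs. agrees c y}) \<le> real (q ^ D)" by (rule of_nat_mono)
  with L show "real (card {c \<in> enc N \<omega> ` msgs. agrees c y}) \<le> L" by linarith
qed

text \<open>A trivial kernel makes the encoding injective, so there are exactly
  \<open>q ^ (n * K)\<close> codewords.\<close>

lemma code_rate_enc:
  fixes R :: real
  assumes \<omega>: "\<omega> \<in> blocks N" and triv: "zero_msgs N (\<lambda>_. {..<n}) \<omega> = {0}" and K: "real K = R * real N" "0 < N"
  shows "code_rate q (n * N) (enc N \<omega> ` msgs) = R"
proof -
  have "inj_on (enc N \<omega>) msgs"
  proof (rule inj_onI)
    fix m m' assume m: "m \<in> msgs" "m' \<in> msgs" and eq: "enc N \<omega> m = enc N \<omega> m'"
    have "vanish {m - m'} {..<n} (\<omega> j)" if j: "j < N" for j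
    proof -
      have "vanish {m - m'} {k} (\<omega> j)" if "k < n" for k
      proof -
        have "j * n + k < (j + 1) * n" using that by simp
        also have "\<dots> \<le> N * n" using j by (intro mult_right_mono) auto
        finally have t: "j * n + k < n * N" by (simp add: mult.commute)
        show ?thesis using enc_nth_eq_iff[OF \<omega> m t] eq that by simp
      qed
      then show ?thesis by (auto simp: vanish_def case_prod_unfold)
    qed
    then have "m - m' \<in> zero_msgs N (\<lambda>_. {..<n}) \<omega>" using m by (simp add: zero_msgs_def msgs_diff)
    then show "m = m'" using triv by simp
  qed
  then have "card (enc N \<omega> ` msgs) = q ^ (n * K)" by (simp add: card_image card_msgs power_mult)
  then have "log q (card (enc N \<omega> ` msgs)) = real (n * K)"
    using q_ge_2 by (simp add: log_nat_power)
  then show ?thesis using K n_pos by (simp add: code_rate_def)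
qed

end

section \<open>Transfer to random generator matrices\<close>

lemma concat_code_eq_enc:
  fixes F :: "(nat \<Rightarrow> 'a::{finite,field}) ring"
  assumes F: "ext_field_coords n F"
    and AG: "A \<in> outer_mats F K N" "G \<in> inner_mats n N"
  shows "concat_code n N G (outer_code F K N A) =
    coord_field.enc n K (mult F) N (block_view n N K (A, G)) ` coord_field.msgs n K"
proof -
  define q where "q = CARD('a)"
  interpret coord_field n K q "mult F" unfolding q_def by (rule coord_field_ext_field(1)[OF F])
  have car: "carrier F = vecs n" using F by (simp add: ext_field_coords_def)
  \<comment> \<open>In \<open>outer_code\<close> the coefficients beyond \<open>K\<close> are
    arbitrary; \<open>z\<close> resets them to zero and thereby maps onto
    \<open>msgs\<close>.\<close>
  define z where "z = (\<lambda>m :: nat \<Rightarrow> nat \<Rightarrow> 'a. \<lambda>i. if i < K then m i else 0)"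
  have word: "concat_word n N G (\<lambda>j. if j < N then finsum F (\<lambda>i. m i \<otimes>\<^bsub>F\<^esub> A i j) {..<K} else undefined)
      = enc N (block_view n N K (A, G)) (z m)" if m: "m \<in> {..<K} \<rightarrow> vecs n" for m
  proof -
    have "finsum F (\<lambda>i. m i \<otimes>\<^bsub>F\<^esub> A i j) {..<K} = ip (z m) (\<lambda>i. if i < K then A i j else 0)" if "j < N" for j
    proof -
      have "m i \<otimes>\<^bsub>F\<^esub> A i j \<in> vecs n" if "i \<in> {..<K}" for i
        using AG(1) \<open>j < N\<close> that m by (intro mul_closed) (auto simp: outer_mats_def car PiE_iff Pi_iff)
      then have "finsum F (\<lambda>i. m i \<otimes>\<^bsub>F\<^esub> A i j) {..<K} = (\<Sum>i<K. m i \<otimes>\<^bsub>F\<^esub> A i j)"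
        by (intro finsum_ext_field[OF F]) auto
      then show ?thesis by (simp add: ip_def z_def)
    qed
    then show ?thesis using n_pos
      by (auto simp: concat_word_def enc_def block_view_def dot_def div_less_blocks intro!: sum.cong)
  qed
  have "z m \<in> msgs" if "m \<in> {..<K} \<rightarrow> vecs n" for m using that by (auto simp: z_def msgs_def)
  moreover have "z m = m" "m \<in> {..<K} \<rightarrow> vecs n" if "m \<in> msgs" for m
    using that by (auto simp: z_def msgs_def fun_eq_iff)
  ultimately have "z ` ({..<K} \<rightarrow> vecs n) = msgs" by force
  moreover have "concat_code n N G (outer_code F K N A) =
      (\<lambda>m. enc N (block_view n N K (A, G)) (z m)) ` ({..<K} \<rightarrow> vecs n)"
    unfolding concat_code_def outer_code_def car using word by (force simp: image_iff)
  ultimately show ?thesis by (metis image_image)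
qed

lemma concat_code_prob_ge:
  fixes F :: "(nat \<Rightarrow> 'a::{finite,field}) ring"
  assumes F: "ext_field_coords n F"
    and good: "\<And>\<omega>. \<omega> \<in> coord_field.blocks n K N \<Longrightarrow> \<not> bad \<omega> \<Longrightarrow>
      good (coord_field.enc n K (mult F) N \<omega> ` coord_field.msgs n K)"
    and bad: "unif_prob (coord_field.blocks n K N) bad \<le> r"
  shows "1 - r \<le> unif_prob (outer_mats F K N \<times> inner_mats n N)
    (\<lambda>(A, G). good (concat_code n N G (outer_code F K N A)))"
proof -
  define q where "q = CARD('a)"
  interpret coord_field n K q "mult F" unfolding q_def by (rule coord_field_ext_field(1)[OF F])
  have "carrier F = vecs n" using F by (simp add: ext_field_coords_def)
  note bij = bij_block_view[OF this, of N]
  show ?thesis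
  proof (rule unif_prob_ge[where P' = "\<lambda>x. bad (block_view n N K x)"])
    show "finite (outer_mats F K N \<times> (inner_mats n N :: (nat \<Rightarrow> nat \<Rightarrow> nat \<Rightarrow> 'a) set))"
      using bij_betw_finite[OF bij] finite_blocks by blast
    show "outer_mats F K N \<times> (inner_mats n N :: (nat \<Rightarrow> nat \<Rightarrow> nat \<Rightarrow> 'a) set) \<noteq> {}"
      using bij blocks_nonempty[of N] by (auto simp: bij_betw_def)
    show "unif_prob (outer_mats F K N \<times> inner_mats n N) (\<lambda>x. bad (block_view n N K x)) \<le> r"
      using unif_prob_bij[OF bij, of bad] bad by simp
    fix x :: "(nat \<Rightarrow> nat \<Rightarrow> nat \<Rightarrow> 'a) \<times> (nat \<Rightarrow> nat \<Rightarrow> nat \<Rightarrow> 'a)"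
    assume x: "x \<in> outer_mats F K N \<times> inner_mats n N"
      and not: "\<not> (case x of (A, G) \<Rightarrow> good (concat_code n N G (outer_code F K N A)))"
    have "block_view n N K x \<in> blocks N" using bij x by (auto simp: bij_betw_def)
    then have "good (concat_code n N (snd x) (outer_code F K N (fst x)))" if "\<not> bad (block_view n N K x)"
      using that x good[of "block_view n N K x"] concat_code_eq_enc[OF F, of "fst x" K N "snd x"] by auto
    with not show "bad (block_view n N K x)" by (auto simp: case_prod_unfold)
  qed
qed

text \<open>The rate claim carries the condition \<open>R < 1\<close>: for \<open>R = 1\<close> and
  large \<open>N\<close> some square inner matrix is singular with high probability, and then the
  encoding is not injective.\<close>

theorem theorem4p5:
  fixes R :: real
  assumes "R \<in> \<rat>" and "0 < R" and "R \<le> 1"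
  shows
   "(\<exists>C>0. \<forall>\<epsilon>>0. \<exists>c>0. \<exists>M::nat. \<forall>n N K (F :: (nat \<Rightarrow> 'a::{finite,field}) ring).
       M \<le> n \<longrightarrow> M \<le> N \<longrightarrow> M \<le> K \<longrightarrow> real K = R * real N \<longrightarrow> ext_field_coords n F \<longrightarrow>
       unif_prob (outer_mats F K N \<times> inner_mats n N)
         (\<lambda>(A, G). led_list_decodable (1 - R - \<epsilon>) (real (card (UNIV :: 'a set)) powr (C / \<epsilon>\<^sup>2)) (n * N)
                      (concat_code n N G (outer_code F K N A)))
       \<ge> 1 - real (card (UNIV :: 'a set)) powr (- c * real n * real N))
    \<and> (R < 1 \<longrightarrow> (\<forall>\<delta>>0. \<exists>M::nat. \<forall>n N K (F :: (nat \<Rightarrow> 'a) ring).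
       M \<le> n \<longrightarrow> M \<le> N \<longrightarrow> M \<le> K \<longrightarrow> real K = R * real N \<longrightarrow> ext_field_coords n F \<longrightarrow>
       unif_prob (outer_mats F K N \<times> inner_mats n N)
         (\<lambda>(A, G). code_rate (card (UNIV :: 'a set)) (n * N) (concat_code n N G (outer_code F K N A)) = R)
       \<ge> 1 - \<delta>))"
proof (intro conjI impI)
  define q where "q = CARD('a)"
  have q: "2 \<le> real q" using two_le_card_field[where 'a = 'a] by (simp add: q_def)
  have "\<exists>c>0. \<exists>M::nat. \<forall>n N K (F :: (nat \<Rightarrow> 'a) ring).
       M \<le> n \<longrightarrow> M \<le> N \<longrightarrow> M \<le> K \<longrightarrow> real K = R * real N \<longrightarrow> ext_field_coords n F \<longrightarrow>
       unif_prob (outer_mats F K N \<times> inner_mats n N)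
         (\<lambda>(A, G). led_list_decodable (1 - R - \<epsilon>) (real q powr (13 / \<epsilon>\<^sup>2)) (n * N)
                      (concat_code n N G (outer_code F K N A)))
       \<ge> 1 - real q powr (- c * real n * real N)" if \<epsilon>: "0 < \<epsilon>" for \<epsilon> :: real
  proof (cases "1 < \<epsilon>")
    case True
    show ?thesis
    proof (intro exI[of _ "1 :: real"] conjI exI[of _ "1 :: nat"] allI impI)
      fix n N K :: nat and F :: "(nat \<Rightarrow> 'a) ring"
      assume n: "1 \<le> n" and N: "1 \<le> N" and F: "ext_field_coords n F"
      \<comment> \<open>For \<open>\<epsilon>\<close> above 1 the permitted number of erasures is
        negative, so no received word has to be considered.\<close>
      have "(1 - R - \<epsilon>) * real (n * N) < 0"
        using True assms(2) n N by (intro mult_neg_pos) auto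
      then have "led_list_decodable (1 - R - \<epsilon>) L (n * N) X" for L and X :: "'a list set"
        unfolding led_list_decodable_def by (smt (verit) of_nat_0_le_iff)
      then show "1 - real q powr (- 1 * real n * real N) \<le>
        unif_prob (outer_mats F K N \<times> inner_mats n N)
         (\<lambda>(A, G). led_list_decodable (1 - R - \<epsilon>) (real q powr (13 / \<epsilon>\<^sup>2)) (n * N)
                      (concat_code n N G (outer_code F K N A)))"
        by (intro concat_code_prob_ge[OF F, where bad = "\<lambda>_. False"]) (auto simp: unif_prob_def)
    qed simp
  next
    case False
    \<comment> \<open>With \<open>\<epsilon> \<le> 1\<close>, rounding gives
      \<open>d \<le> 3 / \<epsilon>\<close>, so \<open>4 / \<epsilon> * d\<close> is at most
      \<open>12 / \<epsilon>\<^sup>2\<close>. Rounding that up to \<open>D\<close> adds less than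
      \<open>1 / \<epsilon>\<^sup>2\<close> or equals it at most, whence the constant 13.\<close>
    define d where "d = nat \<lceil>2 / \<epsilon>\<rceil>"
    define D where "D = nat \<lceil>12 / \<epsilon>\<^sup>2\<rceil>"
    define B where "B = q ^ D"
    \<comment> \<open>The two summands secure the size conditions on \<open>N\<close> and
      \<open>n\<close>; the final 1 makes \<open>N\<close> positive.\<close>
    define M where "M = nat \<lceil>8 * (B * (B + 1)) / \<epsilon>\<rceil> + nat \<lceil>8 * (B + 3) / \<epsilon>\<rceil> + 1"
    have "2 / \<epsilon> \<le> d" "d \<le> 2 / \<epsilon> + 1" using \<epsilon> by (auto simp: d_def)
    then have d: "2 \<le> \<epsilon> * d" "d \<le> 3 / \<epsilon>" using \<epsilon> False by (auto simp: field_simps)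
    have D12: "12 / \<epsilon>\<^sup>2 \<le> D" "D \<le> 12 / \<epsilon>\<^sup>2 + 1" by (auto simp: D_def)
    have "4 / \<epsilon> * d \<le> 4 / \<epsilon> * (3 / \<epsilon>)" using d \<epsilon> by (intro mult_left_mono) auto
    then have dD: "4 / \<epsilon> * d \<le> D" using D12 by (simp add: power2_eq_square)
    have "1 \<le> 1 / \<epsilon>\<^sup>2" using \<epsilon> False by (simp add: power_le_one)
    then have "D \<le> 13 / \<epsilon>\<^sup>2" using D12 by simp
    then have L: "real (q ^ D) \<le> q powr (13 / \<epsilon>\<^sup>2)"
      using q by (simp add: powr_mono flip: powr_realpow)
    show ?thesis
    proof (intro exI[of _ "\<epsilon> / 4"] conjI exI[of _ M] allI impI)
      fix n N K :: nat and F :: "(nat \<Rightarrow> 'a) ring"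
      assume n: "M \<le> n" and N: "M \<le> N" and K: "real K = R * real N" and F: "ext_field_coords n F"
      interpret coord_field n K q "mult F" unfolding q_def by (rule coord_field_ext_field(1)[OF F])
      have "8 * (B * (B + 1)) / \<epsilon> \<le> M" "8 * (B + 3) / \<epsilon> \<le> M" unfolding M_def by linarith+
      then have "8 * (B * (B + 1)) / \<epsilon> \<le> N" "8 * (B + 3) / \<epsilon> \<le> n" using n N by linarith+
      then have nN: "8 * (q ^ D * (q ^ D + 1)) \<le> \<epsilon> * N" "8 * (q ^ D + 3) \<le> \<epsilon> * n"
        using \<epsilon> by (auto simp: B_def field_simps)
      have "0 < N" using N by (simp add: M_def)
      note few = many_zero_msgs_prob_le[OF \<epsilon> this K d(1) dD nN]
      show "1 - real q powr (- (\<epsilon> / 4) * real n * real N) \<le>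
        unif_prob (outer_mats F K N \<times> inner_mats n N)
         (\<lambda>(A, G). led_list_decodable (1 - R - \<epsilon>) (real q powr (13 / \<epsilon>\<^sup>2)) (n * N)
                      (concat_code n N G (outer_code F K N A)))"
        by (rule concat_code_prob_ge[OF F _ few]) (rule list_decodable_enc[OF _ L])
    qed (use \<epsilon> in auto)
  qed
  then show "\<exists>C>0. \<forall>\<epsilon>>0. \<exists>c>0. \<exists>M::nat. \<forall>n N K (F :: (nat \<Rightarrow> 'a) ring).
       M \<le> n \<longrightarrow> M \<le> N \<longrightarrow> M \<le> K \<longrightarrow> real K = R * real N \<longrightarrow> ext_field_coords n F \<longrightarrow>
       unif_prob (outer_mats F K N \<times> inner_mats n N)
         (\<lambda>(A, G). led_list_decodable (1 - R - \<epsilon>) (real (card (UNIV :: 'a set)) powr (C / \<epsilon>\<^sup>2)) (n * N)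
                      (concat_code n N G (outer_code F K N A)))
       \<ge> 1 - real (card (UNIV :: 'a set)) powr (- c * real n * real N)"
    unfolding q_def by (intro exI[of _ "13 :: real"]) auto
  assume "R < 1"
  show "\<forall>\<delta>>0. \<exists>M::nat. \<forall>n N K (F :: (nat \<Rightarrow> 'a) ring).
       M \<le> n \<longrightarrow> M \<le> N \<longrightarrow> M \<le> K \<longrightarrow> real K = R * real N \<longrightarrow> ext_field_coords n F \<longrightarrow>
       unif_prob (outer_mats F K N \<times> inner_mats n N)
         (\<lambda>(A, G). code_rate (card (UNIV :: 'a set)) (n * N) (concat_code n N G (outer_code F K N A)) = R)
       \<ge> 1 - \<delta>"
    unfolding q_def[symmetric]
  proof (intro allI impI)
    fix \<delta> :: real assume "0 < \<delta>"
    \<comment> \<open>The cap at 1 ensures that a base below \<open>\<mu>\<close> only shrinks when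
      raised to the power \<open>N\<close>.\<close>
    define \<mu> where "\<mu> = min \<delta> 1"
    have \<mu>: "0 < \<mu>" "\<mu> \<le> 1" "\<mu> \<le> \<delta>" using \<open>0 < \<delta>\<close> by (auto simp: \<mu>_def)
    \<comment> \<open>Chosen so that \<open>q powr ((1 - R) * n)\<close> exceeds
      \<open>2 ^ q / \<mu>\<close>; the division by \<open>1 - R\<close> is where
      \<open>R < 1\<close> enters.\<close>
    define M where "M = nat \<lceil>log q (2 ^ q / \<mu>) / (1 - R)\<rceil> + 1"
    show "\<exists>M::nat. \<forall>n N K (F :: (nat \<Rightarrow> 'a) ring).
       M \<le> n \<longrightarrow> M \<le> N \<longrightarrow> M \<le> K \<longrightarrow> real K = R * real N \<longrightarrow> ext_field_coords n F \<longrightarrow>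
       unif_prob (outer_mats F K N \<times> inner_mats n N)
         (\<lambda>(A, G). code_rate q (n * N) (concat_code n N G (outer_code F K N A)) = R)
       \<ge> 1 - \<delta>"
    proof (intro exI[of _ M] allI impI)
      fix n N K :: nat and F :: "(nat \<Rightarrow> 'a) ring"
      assume n: "M \<le> n" and N: "M \<le> N" and K: "real K = R * real N" and F: "ext_field_coords n F"
      interpret coord_field n K q "mult F" unfolding q_def by (rule coord_field_ext_field(1)[OF F])
      have N0: "0 < N" using N by (simp add: M_def)
      define y where "y = q powr ((1 - R) * n)"
      define x where "x = 2 ^ q / y"
      have "log q (2 ^ q / \<mu>) / (1 - R) \<le> n" using n unfolding M_def by linarith
      then have "log q (2 ^ q / \<mu>) \<le> (1 - R) * n" using \<open>R < 1\<close> by (simp add: field_simps)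
      then have "q powr log q (2 ^ q / \<mu>) \<le> q powr ((1 - R) * n)" using q by (intro powr_mono) auto
      then have "2 ^ q / \<mu> \<le> y" using q \<mu> by (simp add: y_def powr_log_cancel)
      moreover have "0 < y" using q by (simp add: y_def)
      ultimately have "x \<le> \<mu>" using \<mu> by (simp add: x_def field_simps)
      moreover have "0 \<le> x" by (simp add: x_def y_def)
      ultimately have "x ^ N \<le> \<delta>"
        using power_decreasing[of 1 N x] N0 \<mu> by simp
      \<comment> \<open>With \<open>K = R * N\<close>, the message count \<open>q ^ (n * K)\<close>
        leaves the exponent \<open>- (1 - R) * n\<close> per block, so the bound is an exact
        \<open>N\<close>-th power.\<close>
      moreover have "card msgs * ((2 ^ q) ^ N * (1 / q ^ n) ^ N) = x ^ N"
      proof -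
        have "real (card msgs) = q powr (n * (R * N))"
          using q by (simp add: card_msgs K[symmetric] powr_realpow flip: power_mult of_nat_mult)
        moreover have "(1 / real (q ^ n)) ^ N = q powr (- (real n * N))"
          using q by (simp add: power_divide powr_minus powr_realpow divide_simps
              flip: power_mult of_nat_mult)
        moreover have "y ^ N = q powr ((1 - R) * n * N)"
          using q by (simp add: y_def powr_powr flip: powr_realpow)
        then have "x ^ N = (2 ^ q) ^ N * q powr (- ((1 - R) * n) * N)"
          unfolding x_def power_divide by (simp add: powr_minus divide_inverse)
        moreover have "q powr (- ((1 - R) * n) * N) = q powr (n * (R * N)) * q powr (- (real n * N))"
          by (simp add: algebra_simps flip: powr_add)
        ultimately show ?thesis by simp
      qed
      ultimately have "unif_prob (blocks N) (\<lambda>\<omega>. zero_msgs N (\<lambda>_. {..<n}) \<omega> \<noteq> {0}) \<le> \<delta>"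
        using not_injective_prob_le[of N] by linarith
      then show "1 - \<delta> \<le> unif_prob (outer_mats F K N \<times> inner_mats n N)
         (\<lambda>(A, G). code_rate q (n * N) (concat_code n N G (outer_code F K N A)) = R)"
        by (rule concat_code_prob_ge[OF F, rotated])
          (rule code_rate_enc[OF _ _ K N0], auto)
    qed
  qed
qed

end
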